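(* For every normal operator $A$ in $M_n(L^\infty(\mu))$, the strongly irreducible decomposition of $A$ is unique up to similarity with respect to the relative commutant $\{A\}'\cap M_n(L^\infty(\mu))$; that is, for every two bounded maximal abelian sets of idempotents $\mathscr P$ and $\mathscr Q$ in $\{A\}'\cap M_n(L^\infty(\mu))$, there exists an invertible element $X$ in $\{A\}'\cap M_n(L^\infty(\mu))$ such that $X\mathscr PX^{-1}=\mathscr Q$.
   Context: $\mu$ is (the completion of) a finite positive regular Borel measure supported on a compact subset $\Lambda$ of $\mathbb C$. Elements of $L^\infty(\mu)$ are regarded as multiplication operators on $L^2(\mu)$, and $M_n(L^\infty(\mu))$ acts on $(L^2(\mu))^{(n)}$. The relative commutant is $\{A\}'\cap M_n(L^\infty(\mu))=\{B\in M_n(L^\infty(\mu)):AB=BA\}$. An idempotent is an operator $P$ with $P^2=P$. A bounded maximal abelian set of idempotents in an algebra $\mathfrak A$ of operators is a norm-bounded set of pairwise commuting idempotents of $\mathfrak A$ that is maximal (under inclusion) among sets of pairwise commuting idempotents of $\mathfrak A$. *)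

theory Defs
  imports "HOL-Analysis.Analysis"
begin

definition regular_borel_measure :: "'a::topological_space measure \<Rightarrow> bool" where
  "regular_borel_measure M \<longleftrightarrow> sets M = sets borel \<and>
     (\<forall>B\<in>sets M. emeasure M B = (SUP K\<in>{K. K \<subseteq> B \<and> compact K}. emeasure M K) \<and>
                 emeasure M B = (INF U\<in>{U. B \<subseteq> U \<and> open U}. emeasure M U))"

text \<open>Functions modulo equality almost everywhere. The choice made by \<open>rep\<close> is immaterial: it is
  only used inside integrals and inside \<open>ae_class\<close>.\<close>

definition ae_class :: "'a measure \<Rightarrow> ('a \<Rightarrow> complex) \<Rightarrow> ('a \<Rightarrow> complex) set" where
  "ae_class M f = {g \<in> borel_measurable M. AE z in M. g z = f z}"

definition rep :: "('a \<Rightarrow> complex) set \<Rightarrow> 'a \<Rightarrow> complex" where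
  "rep u = (SOME f. f \<in> u)"

definition L2 :: "'a measure \<Rightarrow> ('a \<Rightarrow> complex) set set" where
  "L2 M = {ae_class M f | f. f \<in> borel_measurable M \<and> integrable M (\<lambda>z. (cmod (f z))\<^sup>2)}"

text \<open>The direct sum of \<open>n = CARD('n)\<close> copies of \<open>L2 M\<close>.\<close>

definition nL2 :: "'a measure \<Rightarrow> (('a \<Rightarrow> complex) set ^ 'n) set" where
  "nL2 M = {x. \<forall>i. x $ i \<in> L2 M}"

definition nL2_inner ::
  "'a measure \<Rightarrow> ('a \<Rightarrow> complex) set ^ 'n \<Rightarrow> ('a \<Rightarrow> complex) set ^ 'n \<Rightarrow> complex" where
  "nL2_inner M x y = (\<Sum>i\<in>UNIV. \<integral>z. rep (x $ i) z * cnj (rep (y $ i) z) \<partial>M)"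

definition nL2_norm :: "'a measure \<Rightarrow> ('a \<Rightarrow> complex) set ^ 'n \<Rightarrow> real" where
  "nL2_norm M x = sqrt (\<Sum>i\<in>UNIV. \<integral>z. (cmod (rep (x $ i) z))\<^sup>2 \<partial>M)"

text \<open>Operators on \<open>nL2 M\<close> are functions that are extensional outside \<open>nL2 M\<close>, so that equality of
  operators is equality of functions; the product is \<open>compose (nL2 M)\<close>.\<close>

type_synonym ('a, 'n) nL2_op = "('a \<Rightarrow> complex) set ^ 'n \<Rightarrow> ('a \<Rightarrow> complex) set ^ 'n"

definition op_mult :: "'a measure \<Rightarrow> ('a, 'n::finite) nL2_op \<Rightarrow> ('a, 'n) nL2_op \<Rightarrow> ('a, 'n) nL2_op" where
  "op_mult M S T = compose (nL2 M) S T"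

definition op_one :: "'a measure \<Rightarrow> ('a, 'n::finite) nL2_op" where
  "op_one M = (\<lambda>x\<in>nL2 M. x)"

definition op_norm :: "'a measure \<Rightarrow> ('a, 'n::finite) nL2_op \<Rightarrow> real" where
  "op_norm M T = (SUP x\<in>{x \<in> nL2 M. nL2_norm M x \<le> 1}. nL2_norm M (T x))"

definition is_adjoint :: "'a measure \<Rightarrow> ('a, 'n::finite) nL2_op \<Rightarrow> ('a, 'n) nL2_op \<Rightarrow> bool" where
  "is_adjoint M T S \<longleftrightarrow> S \<in> nL2 M \<rightarrow>\<^sub>E nL2 M \<and>
     (\<forall>x\<in>nL2 M. \<forall>y\<in>nL2 M. nL2_inner M (T x) y = nL2_inner M x (S y))"

definition normal_op :: "'a measure \<Rightarrow> ('a, 'n::finite) nL2_op \<Rightarrow> bool" where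
  "normal_op M T \<longleftrightarrow> (\<exists>S. is_adjoint M T S \<and> op_mult M S T = op_mult M T S)"

text \<open>Elements of \<open>Linf\<close> are representatives; passing to the operators in \<open>matrix_op\<close> identifies
  functions that agree almost everywhere.\<close>

definition Linf :: "'a measure \<Rightarrow> ('a \<Rightarrow> complex) set" where
  "Linf M = {f \<in> borel_measurable M. \<exists>C. AE z in M. cmod (f z) \<le> C}"

definition matrix_op :: "'a measure \<Rightarrow> ('a \<Rightarrow> complex) ^ 'n ^ 'n \<Rightarrow> ('a, 'n::finite) nL2_op" where
  "matrix_op M F =
     (\<lambda>x\<in>nL2 M. \<chi> i. ae_class M (\<lambda>z. \<Sum>j\<in>UNIV. (F $ i $ j) z * rep (x $ j) z))"

definition Mn_Linf :: "'a measure \<Rightarrow> ('a, 'n::finite) nL2_op set" where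
  "Mn_Linf M = {matrix_op M F | F. \<forall>i j. F $ i $ j \<in> Linf M}"

definition rel_commutant :: "'a measure \<Rightarrow> ('a, 'n::finite) nL2_op \<Rightarrow> ('a, 'n) nL2_op set" where
  "rel_commutant M A = {B \<in> Mn_Linf M. op_mult M A B = op_mult M B A}"

definition abelian_idempotents ::
  "'a measure \<Rightarrow> ('a, 'n::finite) nL2_op set \<Rightarrow> ('a, 'n) nL2_op set \<Rightarrow> bool" where
  "abelian_idempotents M \<AA> \<P> \<longleftrightarrow> \<P> \<subseteq> \<AA> \<and> (\<forall>P\<in>\<P>. op_mult M P P = P) \<and>
     (\<forall>P\<in>\<P>. \<forall>Q\<in>\<P>. op_mult M P Q = op_mult M Q P)"

text \<open>Maximality is among all abelian sets of idempotents, not only the bounded ones.\<close>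

definition bounded_max_abelian_idempotents ::
  "'a measure \<Rightarrow> ('a, 'n::finite) nL2_op set \<Rightarrow> ('a, 'n) nL2_op set \<Rightarrow> bool" where
  "bounded_max_abelian_idempotents M \<AA> \<P> \<longleftrightarrow>
     abelian_idempotents M \<AA> \<P> \<and> (\<exists>C. \<forall>P\<in>\<P>. op_norm M P \<le> C) \<and>
     (\<forall>\<R>. abelian_idempotents M \<AA> \<R> \<and> \<P> \<subseteq> \<R> \<longrightarrow> \<R> = \<P>)"

end

theory Submission
  imports Defs "HOL-Computational_Algebra.Fundamental_Theorem_Algebra"
begin

text \<open>An element of \<open>Mn_Linf M\<close> is a matrix-valued function up to null sets, so everything is done
  fibrewise, with all choices measurable. Let \<open>\<P>\<close> be a bounded maximal abelian set of idempotents
  in the relative commutant of \<open>A\<close>. The uniform bound makes \<open>\<P>\<close> closed under countable gluing along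
  measurable partitions; hence among the resolutions \<open>1 = \<Sum>i. E i\<close> of the identity into \<open>n\<close> orthogonal
  elements of \<open>\<P>\<close> some one maximizes the integral of the number of nonzero \<open>E i z\<close>. At the maximum all
  \<open>E i z\<close> are nonzero almost everywhere, and so have rank one. Otherwise some \<open>E j\<close> vanishes and some
  \<open>E i\<close> has higher rank on a set of positive measure. Below \<open>E i\<close> there is a rank-one idempotent built
  from a measurable eigenvector of \<open>A z\<close> in the range of \<open>E i z\<close>. This is where normality enters: the
  eigenvector is also one of the adjoint, so the rank-one idempotent commutes with \<open>A z\<close>. If no element
  of \<open>\<P>\<close> split \<open>E i\<close> there, this idempotent would commute with \<open>\<P>\<close> and so belong to \<open>\<P>\<close>; hence some
  element of \<open>\<P>\<close> does split \<open>E i\<close>, and moving one part to position \<open>j\<close> increases the integral.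

  Thus there are bounded measurable \<open>U\<close> and \<open>V = U\<^sup>-\<^sup>1\<close> such that \<open>V A U\<close> is diagonal and \<open>\<P>\<close>
  consists exactly of the idempotents \<open>G\<close> with \<open>V G U\<close> diagonal. For a second such set, with frame
  \<open>U'\<close>, \<open>V'\<close>, the diagonal matrices \<open>V A U\<close> and \<open>V' A U'\<close> are similar, hence equal up to a measurable
  field \<open>p\<close> of permutations, and \<open>X = U' p\<^sup>-\<^sup>1 V\<close> conjugates one set to the other.\<close>

section \<open>Measurable selection\<close>

text \<open>Lexicographic minimization over the coordinates shrinks the sets \<open>K z\<close> to points.\<close>

lemma measurable_selection_compact:
  fixes K :: "'a \<Rightarrow> 'b::euclidean_space set"
  assumes K: "\<And>z. z \<in> space M \<Longrightarrow> compact (K z) \<and> K z \<noteq> {}"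
    and meas: "\<And>C. closed C \<Longrightarrow> {z \<in> space M. K z \<inter> C \<noteq> {}} \<in> sets M"
  shows "\<exists>f \<in> borel_measurable M. \<forall>z\<in>space M. f z \<in> K z"
proof -
  \<comment> \<open>The induction runs over a set \<open>B\<close> of basis vectors: the coordinates
    along \<open>B\<close> have become constant on \<open>K' z\<close>, while compactness and
    measurable hitting of closed sets are preserved.\<close>
  have "\<exists>K'. (\<forall>z\<in>space M. compact (K' z) \<and> K' z \<noteq> {} \<and> K' z \<subseteq> K z \<and>
             (\<forall>b\<in>B. \<forall>x\<in>K' z. \<forall>y\<in>K' z. x \<bullet> b = y \<bullet> b)) \<and>
          (\<forall>C. closed C \<longrightarrow> {z \<in> space M. K' z \<inter> C \<noteq> {}} \<in> sets M)" if "finite B" for B :: "'b set"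
    using that
  proof (induction B)
    case empty
    then show ?case using assms by (intro exI[of _ K]) auto
  next
    case (insert b B)
    then obtain L where L0: "\<forall>z\<in>space M. compact (L z) \<and> L z \<noteq> {} \<and> L z \<subseteq> K z \<and>
             (\<forall>b\<in>B. \<forall>x\<in>L z. \<forall>y\<in>L z. x \<bullet> b = y \<bullet> b)"
        "\<forall>C. closed C \<longrightarrow> {z \<in> space M. L z \<inter> C \<noteq> {}} \<in> sets M"
      by (elim exE conjE)
    have L: "\<And>z. z \<in> space M \<Longrightarrow> compact (L z) \<and> L z \<noteq> {} \<and> L z \<subseteq> K z"
        "\<And>z b x y. z \<in> space M \<Longrightarrow> b \<in> B \<Longrightarrow> x \<in> L z \<Longrightarrow> y \<in> L z \<Longrightarrow> x \<bullet> b = y \<bullet> b"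
        "\<And>C. closed C \<Longrightarrow> {z \<in> space M. L z \<inter> C \<noteq> {}} \<in> sets M"
      subgoal using L0(1) by meson
      subgoal using L0(1) by meson
      subgoal using L0(2) by meson
      done
    define L' where "L' = (\<lambda>z. {x \<in> L z. \<forall>y\<in>L z. x \<bullet> b \<le> y \<bullet> b})"
    have min: "\<exists>x\<in>S. \<forall>y\<in>S. x \<bullet> b \<le> y \<bullet> b" if "compact S" "S \<noteq> {}" for S
      using that by (intro continuous_attains_inf) (auto intro!: continuous_intros)
    have cpt: "compact (L' z)" if "z \<in> space M" for z
    proof -
      have "L' z = L z \<inter> (\<Inter>y\<in>L z. {x. x \<bullet> b \<le> y \<bullet> b})" by (auto simp: L'_def)
      moreover have "closed (\<Inter>y\<in>L z. {x. x \<bullet> b \<le> y \<bullet> b})"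
        by (intro closed_INT ballI closed_Collect_le continuous_intros)
      ultimately show ?thesis using L(1)[OF that] by (simp add: compact_Int_closed)
    qed
    have ne: "L' z \<noteq> {}" if "z \<in> space M" for z
      using min[of "L z"] L(1)[OF that] by (auto simp: L'_def)
    have sub: "L' z \<subseteq> K z" if "z \<in> space M" for z
      using L(1)[OF that] by (auto simp: L'_def)
    have sets: "{z \<in> space M. L' z \<inter> C \<noteq> {}} \<in> sets M" if C: "closed C" for C
    proof -
      let ?H = "\<lambda>q::real. {x. x \<bullet> b \<le> q}"
      have cH: "closed (?H q)" for q
        by (intro closed_Collect_le continuous_intros)
      \<comment> \<open>A minimizer over \<open>L z\<close> lies in \<open>C\<close> iff every
        sublevel set that meets \<open>L z\<close> meets it inside \<open>C\<close>. Rational levels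
        suffice, so the condition is a countable combination of hitting conditions for
        \<open>L\<close>.\<close>
      have eq: "L' z \<inter> C \<noteq> {} \<longleftrightarrow> (\<forall>q\<in>\<rat>. L z \<inter> ?H q \<noteq> {} \<longrightarrow> L z \<inter> (C \<inter> ?H q) \<noteq> {})"
        (is "_ \<longleftrightarrow> ?R") if z: "z \<in> space M" for z
      proof
        assume "L' z \<inter> C \<noteq> {}"
        then show ?R by (fastforce simp: L'_def)
      next
        assume R: ?R
        obtain m where m: "m \<in> L z" "\<And>y. y \<in> L z \<Longrightarrow> m \<bullet> b \<le> y \<bullet> b"
          using min[of "L z"] L(1)[OF z] by auto
        \<comment> \<open>Any rational level above the minimum shows that \<open>L z\<close> meets
          \<open>C\<close>, so a minimizer over the intersection exists.\<close>
        obtain q0 where "q0 \<in> \<rat>" "m \<bullet> b < q0" using Rats_dense_in_real[of "m \<bullet> b" "m \<bullet> b + 1"] by auto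
        then have "L z \<inter> C \<noteq> {}" using R m(1) by fastforce
        moreover have "compact (L z \<inter> C)" using L(1)[OF z] C by (simp add: compact_Int_closed)
        ultimately obtain x where x: "x \<in> L z" "x \<in> C" "\<And>y. y \<in> L z \<inter> C \<Longrightarrow> x \<bullet> b \<le> y \<bullet> b"
          using min[of "L z \<inter> C"] by auto
        have "x \<bullet> b \<le> m \<bullet> b"
        proof (rule ccontr)
          assume "\<not> ?thesis"
          then obtain q where q: "q \<in> \<rat>" "m \<bullet> b < q" "q < x \<bullet> b"
            using Rats_dense_in_real[of "m \<bullet> b" "x \<bullet> b"] by auto
          then have "L z \<inter> ?H q \<noteq> {}" using m(1) by (auto intro!: exI[of _ m])
          with R q(1) obtain y where "y \<in> L z" "y \<in> C" "y \<bullet> b \<le> q" by blast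
          then show False using x(3)[of y] q(3) by auto
        qed
        then have "x \<bullet> b \<le> y \<bullet> b" if "y \<in> L z" for y using m(2)[OF that] by linarith
        then have "x \<in> L' z" using x(1) by (simp add: L'_def)
        then show "L' z \<inter> C \<noteq> {}" using x by auto
      qed
      have "{z \<in> space M. L' z \<inter> C \<noteq> {}} =
        {z \<in> space M. \<forall>q\<in>\<rat>. L z \<inter> ?H q \<noteq> {} \<longrightarrow> L z \<inter> (C \<inter> ?H q) \<noteq> {}}"
        using eq by (intro Collect_cong conj_cong refl)
      also have "\<dots> \<in> sets M"
        by (intro sets.sets_Collect_countable_All' sets.sets_Collect_imp L(3) cH closed_Int C countable_rat)
      finally show ?thesis .
    qed
    show ?case
    proof (intro exI[of _ L'] conjI ballI allI impI)
      fix z c x y assume z: "z \<in> space M" and c: "c \<in> insert b B" and xy: "x \<in> L' z" "y \<in> L' z"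
      show "x \<bullet> c = y \<bullet> c"
      proof (cases "c = b")
        case True
        have "x \<bullet> b \<le> y \<bullet> b" "y \<bullet> b \<le> x \<bullet> b" using xy by (simp_all add: L'_def)
        then show ?thesis using True by simp
      next
        case False
        show ?thesis
          by (rule L(2)[OF z]) (use c False xy in \<open>auto simp: L'_def\<close>)
      qed
    qed (use cpt ne sets sub in \<open>blast+\<close>)
  qed
  from this[OF finite_Basis] obtain K' where K0: "\<forall>z\<in>space M. compact (K' z) \<and> K' z \<noteq> {} \<and> K' z \<subseteq> K z \<and>
             (\<forall>b\<in>Basis. \<forall>x\<in>K' z. \<forall>y\<in>K' z. x \<bullet> b = y \<bullet> b)"
    and K'3: "\<forall>C. closed C \<longrightarrow> {z \<in> space M. K' z \<inter> C \<noteq> {}} \<in> sets M"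
    by (elim exE conjE)
  have K': "\<And>z. z \<in> space M \<Longrightarrow> K' z \<noteq> {} \<and> K' z \<subseteq> K z"
      "\<And>z b x y. z \<in> space M \<Longrightarrow> b \<in> Basis \<Longrightarrow> x \<in> K' z \<Longrightarrow> y \<in> K' z \<Longrightarrow> x \<bullet> b = y \<bullet> b"
      "\<And>C. closed C \<Longrightarrow> {z \<in> space M. K' z \<inter> C \<noteq> {}} \<in> sets M"
    subgoal using K0 by meson
    subgoal using K0 by meson
    subgoal using K'3 by meson
    done
  define f where "f = (\<lambda>z. SOME x. x \<in> K' z)"
  have f: "f z \<in> K' z" if "z \<in> space M" for z
    unfolding f_def using K'(1)[OF that] by (simp add: some_in_eq)
  have sing: "K' z = {f z}" if "z \<in> space M" for z
  proof -
    have "x = f z" if "x \<in> K' z" for x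
      by (rule euclidean_eqI) (rule K'(2)[OF \<open>z \<in> space M\<close> _ that f[OF \<open>z \<in> space M\<close>]])
    then show ?thesis using f[OF that] by blast
  qed
  have "f \<in> borel_measurable M"
  proof (rule borel_measurableI)
    fix S :: "'b set" assume "open S"
    \<comment> \<open>As \<open>K' z\<close> is the single point \<open>f z\<close>, the preimage of
      \<open>S\<close> is the complement of a hitting set of the closed set
      \<open>- S\<close>.\<close>
    then have "space M - {z \<in> space M. K' z \<inter> (- S) \<noteq> {}} \<in> sets M"
      by (intro sets.compl_sets K'(3)) (simp add: closed_Compl)
    also have "space M - {z \<in> space M. K' z \<inter> (- S) \<noteq> {}} = f -` S \<inter> space M"
      using sing by auto
    finally show "f -` S \<inter> space M \<in> sets M" .
  qed
  then show ?thesis using f K'(1) by (intro bexI[of _ f]) auto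
qed

text \<open>On a compact set a continuous nonnegative function has a zero iff its infimum is 0, and
  the infimum may be tested on a countable dense subset. This leaves only countable
  quantifiers.\<close>

lemma sets_Collect_zero_on_compact:
  fixes g :: "'a \<Rightarrow> 'b::euclidean_space \<Rightarrow> real"
  assumes "compact C" and meas: "\<And>v. (\<lambda>z. g z v) \<in> borel_measurable M"
    and cont: "\<And>z. continuous_on C (g z)" and nonneg: "\<And>z v. 0 \<le> g z v"
  shows "{z \<in> space M. \<exists>v\<in>C. g z v = 0} \<in> sets M"
proof -
  obtain D where D: "countable D" "D \<subseteq> C" "C \<subseteq> closure D"
    using separable by blast
  have "(\<exists>v\<in>C. g z v = 0) \<longleftrightarrow> (\<forall>n. \<exists>d\<in>D. g z d < 1 / real (Suc n))" (is "?L \<longleftrightarrow> ?R") for z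
  proof
    assume ?L
    then obtain v where v: "v \<in> C" "g z v = 0" by auto
    show ?R
    proof
      fix n
      obtain e where e: "e > 0" "\<And>y. y \<in> C \<Longrightarrow> dist y v < e \<Longrightarrow> dist (g z y) (g z v) < 1 / real (Suc n)"
        using cont[of z] v(1) unfolding continuous_on_iff by (metis zero_less_divide_1_iff of_nat_0_less_iff zero_less_Suc)
      obtain d where "d \<in> D" "dist d v < e"
        using v(1) D(3) e(1) closure_approachable[of v D] by blast
      then show "\<exists>d\<in>D. g z d < 1 / real (Suc n)"
        using e(2)[of d] D(2) v(2) nonneg[of z d] by (auto simp: dist_real_def intro!: bexI[of _ d])
    qed
  next
    assume R: ?R
    then have "C \<noteq> {}" using D(2) by fastforce
    then obtain v where v: "v \<in> C" "\<And>y. y \<in> C \<Longrightarrow> g z v \<le> g z y"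
      using continuous_attains_inf[OF assms(1) _ cont[of z]] by blast
    have "g z v < 1 / real (Suc n)" for n
      using R D(2) v(2) by (meson order.strict_trans1 subsetD)
    then have "g z v \<le> 0"
      by (metis inverse_eq_divide reals_Archimedean not_le order.strict_trans order.irrefl)
    then show ?L using v(1) nonneg[of z v] by (auto intro!: bexI[of _ v])
  qed
  then have "{z \<in> space M. \<exists>v\<in>C. g z v = 0} = {z \<in> space M. \<forall>n. \<exists>d\<in>D. g z d < 1 / real (Suc n)}"
    by simp
  also have "\<dots> \<in> sets M"
    using meas D(1) by (intro sets.sets_Collect_countable_All sets.sets_Collect_countable_Bex) measurable
  finally show ?thesis .
qed

section \<open>Eigenvectors in the range of a commuting idempotent\<close>

text \<open>More vectors than the dimension are dependent. A repeated vector is treated separately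
  because \<open>vec.dependent\<close> concerns the set of values, in which repetitions
  disappear.\<close>

lemma nontrivial_vanishing_combination:
  fixes f :: "nat \<Rightarrow> complex^'n"
  shows "\<exists>c. (\<exists>i\<le>CARD('n). c i \<noteq> 0) \<and> (\<Sum>i\<le>CARD('n). c i *s f i) = 0"
proof (cases "inj_on f {..CARD('n)}")
  case False
  then obtain i j where ij: "i \<le> CARD('n)" "j \<le> CARD('n)" "i \<noteq> j" "f i = f j"
    by (auto simp: inj_on_def)
  define c where "c = (\<lambda>k. if k = i then 1 else if k = j then -1 else (0::complex))"
  have "(\<Sum>k\<le>CARD('n). c k *s f k) = (\<Sum>k\<in>{i, j}. c k *s f k)"
    using ij by (intro sum.mono_neutral_right) (auto simp: c_def)
  also have "\<dots> = 0" using ij by (simp add: c_def vec_eq_iff)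
  finally show ?thesis using ij by (intro exI[of _ c]) (auto simp: c_def)
next
  case True
  let ?S = "f ` {..CARD('n)}"
  have "vec.dependent ?S"
  proof (rule ccontr)
    assume "\<not> ?thesis"
    then have "card ?S = vec.dim ?S" by (simp add: vec.dim_eq_card_independent)
    also have "\<dots> \<le> CARD('n)" using vec.dim_subset[of ?S UNIV] by (simp only: vec_dim_card) simp
    finally show False using True by (simp add: card_image)
  qed
  then obtain u where u: "\<exists>v\<in>?S. u v \<noteq> 0" "(\<Sum>v\<in>?S. u v *s v) = 0"
    by (subst (asm) vec.dependent_finite) auto
  then show ?thesis using True
    by (intro exI[of _ "\<lambda>i. u (f i)"]) (auto simp: sum.reindex)
qed

text \<open>The last assumption says that p(A) x = 0. For a root \<open>l\<close> of
  \<open>p\<close> and p = (X - l) q, the vector y = A x - l x either vanishes, and then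
  \<open>x\<close> is an eigenvector, or is annihilated by q(A) and still fixed by \<open>E\<close>,
  so the degree drops.\<close>

lemma eigenvector_of_annihilating_poly:
  fixes A E :: "complex^'n^'n"
  assumes AE: "A ** E = E ** A"
    and "p \<noteq> 0" "x \<noteq> 0" "E *v x = x" "(\<Sum>i\<le>degree p. coeff p i *s ((*v) A ^^ i) x) = 0"
  shows "\<exists>v l. v \<noteq> 0 \<and> E *v v = v \<and> A *v v = l *s v"
  using assms(2-)
proof (induction "degree p" arbitrary: p x)
  case 0
  then show ?case using leading_coeff_0_iff[of p] by simp
next
  case (Suc d)
  have "\<not> constant (poly p)" using Suc(2) by (metis constant_degree nat.distinct(1))
  then obtain l where "poly p l = 0" using fundamental_theorem_of_algebra by blast
  then obtain q where q: "p = [:-l, 1:] * q" by (auto simp: poly_eq_0_iff_dvd)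
  have "q \<noteq> 0" using q Suc by auto
  then have dq: "degree q = d" using Suc(2) unfolding q by (subst (asm) degree_mult_eq) auto
  define T where "T = (\<lambda>i. ((*v) A ^^ i) x)"
  define y where "y = A *v x - l *s x"
  have Tlin: "((*v) A ^^ i) y = T (Suc i) - l *s T i" for i
  proof (induction i)
    case 0
    then show ?case by (simp add: T_def y_def)
  next
    case (Suc i)
    then show ?case by (simp add: T_def matrix_vector_mult_diff_distrib vector_scalar_commute)
  qed
  have c0: "coeff p 0 = - l * coeff q 0" by (simp add: q)
  have cS: "coeff p (Suc i) = coeff q i - l * coeff q (Suc i)" for i by (simp add: q)
  have qd: "coeff q (Suc d) = 0" using dq by (simp add: coeff_eq_0)
  \<comment> \<open>The coefficients of (X - l) q turn p(A) x into q(A) y. The sum shifted by one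
    reaches index \<open>Suc d\<close>, where \<open>coeff q\<close> is 0 by
    \<open>qd\<close>.\<close>
  have "0 = (\<Sum>i\<le>Suc d. coeff p i *s T i)" using Suc by (simp add: T_def)
  also have "\<dots> = (\<Sum>i\<le>d. coeff q i *s T (Suc i)) - ((l * coeff q 0) *s T 0 + (\<Sum>i\<le>d. (l * coeff q (Suc i)) *s T (Suc i)))"
    by (subst sum.atMost_Suc_shift)
      (simp add: c0 cS vec.scale_left_diff_distrib sum_subtractf)
  also have "(l * coeff q 0) *s T 0 + (\<Sum>i\<le>d. (l * coeff q (Suc i)) *s T (Suc i)) = (\<Sum>i\<le>d. (l * coeff q i) *s T i)"
    using sum.atMost_Suc_shift[of "\<lambda>i. (l * coeff q i) *s T i" d] by (simp add: qd)
  also have "(\<Sum>i\<le>d. coeff q i *s T (Suc i)) - \<dots> = (\<Sum>i\<le>degree q. coeff q i *s ((*v) A ^^ i) y)"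
    by (simp add: Tlin dq sum_subtractf vec.scale_right_diff_distrib mult.commute)
  finally have qy: "(\<Sum>i\<le>degree q. coeff q i *s ((*v) A ^^ i) y) = 0" by simp
  have Ey: "E *v y = y"
    using Suc(5) AE by (simp add: y_def matrix_vector_mult_diff_distrib vector_scalar_commute)
      (metis matrix_vector_mul_assoc)
  show ?case
  proof (cases "y = 0")
    case True
    then show ?thesis using Suc(4,5) by (auto simp: y_def)
  next
    case False
    then show ?thesis using Suc(1)[of q y] dq \<open>q \<noteq> 0\<close> Ey qy by auto
  qed
qed

text \<open>For a nonzero \<open>x\<close> in the range of \<open>E\<close> the vectors A^i x with i
  at most n are dependent, which yields a nonzero polynomial in \<open>A\<close> annihilating
  \<open>x\<close>.\<close>

lemma eigenvector_in_range_of_commuting_idempotent: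
  fixes A E :: "complex^'n^'n"
  assumes "A ** E = E ** A" "E ** E = E" "E \<noteq> 0"
  shows "\<exists>v l. norm v = 1 \<and> E *v v = v \<and> A *v v = l *s v"
proof -
  obtain w where "E *v w \<noteq> 0" using assms(3) by (metis matrix_eq matrix_vector_mult_0)
  define x where "x = E *v w"
  have x: "x \<noteq> 0" "E *v x = x"
    using \<open>E *v w \<noteq> 0\<close> assms(2) by (simp_all add: x_def matrix_vector_mul_assoc)
  obtain c i where c: "i \<le> CARD('n)" "c i \<noteq> 0" "(\<Sum>i\<le>CARD('n). c i *s ((*v) A ^^ i) x) = 0"
    using nontrivial_vanishing_combination[of "\<lambda>i. ((*v) A ^^ i) x"] by blast
  define p where "p = (\<Sum>i\<le>CARD('n). monom (c i) i)"
  have cp: "coeff p k = (if k \<le> CARD('n) then c k else 0)" for k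
    by (simp add: p_def coeff_sum coeff_monom)
  then have "p \<noteq> 0" using c by (metis coeff_0)
  have "degree p \<le> CARD('n)" by (intro degree_le) (auto simp: cp)
  then have "(\<Sum>i\<le>degree p. coeff p i *s ((*v) A ^^ i) x) = (\<Sum>i\<le>CARD('n). coeff p i *s ((*v) A ^^ i) x)"
    by (intro sum.mono_neutral_left) (auto simp: coeff_eq_0)
  also have "\<dots> = 0" using c(3) by (simp add: cp)
  finally obtain v l where v: "v \<noteq> 0" "E *v v = v" "A *v v = l *s v"
    using eigenvector_of_annihilating_poly[OF assms(1) \<open>p \<noteq> 0\<close> x] by blast
  define r where "r = complex_of_real (inverse (norm v))"
  have "norm (r *s v) = 1"
  proof -
    have "r *s v = (inverse (norm v)) *\<^sub>R v" unfolding vec_eq_iff by (simp add: r_def) (simp add: scaleR_conv_of_real)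
    then show ?thesis using v by simp
  qed
  then show ?thesis using v
    by (intro exI[of _ "r *s v"] exI[of _ l])
      (simp add: vector_scalar_commute vector_smult_assoc mult.commute)
qed

section \<open>Complex matrices\<close>

definition adjm :: "complex^'n^'n \<Rightarrow> complex^'n^'n" where
  "adjm A = (\<chi> i j. cnj (A $ j $ i))"

definition cdot :: "complex^'n \<Rightarrow> complex^'n \<Rightarrow> complex" where
  "cdot x y = (\<Sum>i\<in>UNIV. x $ i * cnj (y $ i))"

text \<open>The operator v w^*, sending x to \<open>cdot x w *s v\<close>; its rank is at most
  one.\<close>

definition outer :: "complex^'n \<Rightarrow> complex^'n \<Rightarrow> complex^'n^'n" where
  "outer v w = (\<chi> i j. v $ i * cnj (w $ j))"

lemma cdot_self: "cdot x x = complex_of_real ((norm x)\<^sup>2)"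
  by (simp add: cdot_def norm_vec_def L2_set_def sum_nonneg complex_norm_square
      del: of_real_power)

lemma cdot_adjm: "cdot (A *v x) y = cdot x (adjm A *v y)"
proof -
  have "cdot (A *v x) y = (\<Sum>i\<in>UNIV. \<Sum>j\<in>UNIV. A $ i $ j * x $ j * cnj (y $ i))"
    by (simp add: cdot_def matrix_vector_mult_def sum_distrib_right)
  also have "\<dots> = (\<Sum>j\<in>UNIV. \<Sum>i\<in>UNIV. A $ i $ j * x $ j * cnj (y $ i))" by (rule sum.swap)
  also have "\<dots> = cdot x (adjm A *v y)"
    by (simp add: cdot_def matrix_vector_mult_def adjm_def sum_distrib_left mult_ac)
  finally show ?thesis .
qed

lemma adjm_adjm [simp]: "adjm (adjm A) = A"
  by (simp add: adjm_def vec_eq_iff)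

lemma adjm_diff: "adjm (A - B) = adjm A - adjm B"
  by (simp add: adjm_def vec_eq_iff)

lemma adjm_mat: "adjm (mat l) = mat (cnj l)"
  by (auto simp: adjm_def mat_def vec_eq_iff)

lemma mat_mult_vec: "mat l *v x = l *s (x::complex^'n)"
  by (simp add: vec_eq_iff mat_def matrix_vector_mult_def if_distrib[of "\<lambda>a. a * b" for b] cong: if_cong)

lemma mat_mult_commute: "mat l ** A = A ** mat (l::complex)"
  by (simp add: vec_eq_iff mat_def matrix_matrix_mult_def if_distrib[of "\<lambda>a. a * b" for b]
      if_distrib[of "\<lambda>a. b * a" for b] mult.commute cong: if_cong)

lemma matrix_diff_ldistrib: "A ** (B - C) = A ** B - A ** (C::complex^'n^'n)"
  by (simp add: vec_eq_iff matrix_matrix_mult_def sum_subtractf algebra_simps)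

lemma matrix_diff_rdistrib: "(B - C) ** A = B ** A - C ** (A::complex^'n^'n)"
  by (simp add: vec_eq_iff matrix_matrix_mult_def sum_subtractf algebra_simps)

lemma normal_matrix_norm:
  assumes "A ** adjm A = adjm A ** A"
  shows "norm (adjm A *v x) = norm (A *v x)"
proof -
  have "cdot (adjm A *v x) (adjm A *v x) = cdot (A *v x) (A *v x)"
    using assms by (simp add: cdot_adjm matrix_vector_mul_assoc)
  then show ?thesis by (simp add: cdot_self del: of_real_power)
qed

text \<open>The matrix \<open>A - mat l\<close> is normal too, hence has the same kernel as its
  adjoint.\<close>

lemma normal_matrix_adjoint_eigenvector:
  assumes "A ** adjm A = adjm A ** A" "A *v x = l *s x"
  shows "adjm A *v x = cnj l *s x"
proof -
  let ?B = "A - mat l"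
  have "?B ** adjm ?B = adjm ?B ** ?B"
    using assms(1) mat_mult_commute[of l "adjm A"] mat_mult_commute[of "cnj l" A]
      mat_mult_commute[of l "mat (cnj l)"]
    by (simp add: adjm_diff adjm_mat matrix_diff_ldistrib matrix_diff_rdistrib algebra_simps)
  from normal_matrix_norm[OF this, of x] have "norm (adjm ?B *v x) = 0"
    using assms(2) by (simp add: matrix_vector_mult_diff_rdistrib mat_mult_vec)
  then show ?thesis by (simp add: adjm_diff adjm_mat matrix_vector_mult_diff_rdistrib mat_mult_vec)
qed

lemma matrix_mult_outer: "A ** outer v w = outer (A *v v) w"
  by (simp add: outer_def vec_eq_iff matrix_matrix_mult_def matrix_vector_mult_def sum_distrib_right mult.assoc)

lemma outer_matrix_mult: "outer v w ** A = outer v (adjm A *v w)"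
  by (simp add: outer_def vec_eq_iff matrix_matrix_mult_def matrix_vector_mult_def adjm_def sum_distrib_left mult_ac)

lemma outer_mult_vec: "outer v w *v x = cdot x w *s v"
  by (simp add: outer_def vec_eq_iff matrix_vector_mult_def cdot_def sum_distrib_left mult_ac)

lemma outer_scale: "outer (l *s v) w = outer v (cnj l *s w)"
  by (simp add: outer_def vec_eq_iff mult_ac)

lemma outer_zero [simp]: "outer 0 w = 0"
  by (simp add: outer_def vec_eq_iff)

lemma matrix_mult_zero [simp]: "A ** 0 = (0::complex^'n^'n)" "0 ** A = (0::complex^'n^'n)"
  by (simp_all add: vec_eq_iff matrix_matrix_mult_def)

text \<open>The operator \<open>outer v v ** E\<close> is idempotent because \<open>v\<close> lies in the range of \<open>E\<close>; it commutes
  with \<open>A\<close> because \<open>v\<close> is also an eigenvector of the adjoint.\<close>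

lemma rank_one_subidempotent:
  fixes A E :: "complex^'n^'n"
  assumes "A ** adjm A = adjm A ** A" "A ** E = E ** A" "E ** E = E"
    and v: "norm v = 1" "E *v v = v" "A *v v = l *s v"
  defines "R \<equiv> outer v v ** E"
  shows "R ** R = R" "E ** R = R" "R ** E = R" "A ** R = R ** A" "R *v v = v"
proof -
  show ER: "E ** R = R" using v by (simp add: R_def matrix_mul_assoc matrix_mult_outer)
  show "R ** E = R" using assms(3) by (simp add: R_def flip: matrix_mul_assoc)
  have "outer v v ** outer v v = outer v v"
    using v(1) by (simp add: matrix_mult_outer outer_mult_vec cdot_self)
  then show "R ** R = R" using ER by (metis R_def matrix_mul_assoc)
  have "A ** outer v v = outer v v ** A"
    using normal_matrix_adjoint_eigenvector[OF assms(1) v(3)] v(3)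
    by (simp add: matrix_mult_outer outer_matrix_mult outer_scale)
  then show "A ** R = R ** A" using assms(2) unfolding R_def by (metis matrix_mul_assoc)
  show "R *v v = v"
    using v by (simp add: R_def outer_mult_vec cdot_self flip: matrix_vector_mul_assoc)
qed

section \<open>Continuity, measurability and bounds for matrix operations\<close>

lemma bounded_bilinear_matrix_mult:
  "bounded_bilinear ((**) :: complex^'n^'n \<Rightarrow> complex^'n^'n \<Rightarrow> complex^'n^'n)"
  by (subst bilinear_conv_bounded_bilinear[symmetric])
    (auto simp: bilinear_def linear_iff matrix_matrix_mult_def vec_eq_iff sum.distrib algebra_simps scaleR_sum_right)

lemma bounded_bilinear_matrix_vector_mult:
  "bounded_bilinear ((*v) :: complex^'n^'n \<Rightarrow> complex^'n \<Rightarrow> complex^'n)"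
  by (subst bilinear_conv_bounded_bilinear[symmetric])
    (auto simp: bilinear_def linear_iff matrix_vector_mult_def vec_eq_iff sum.distrib algebra_simps scaleR_sum_right)

lemmas continuous_on_matrix_mult [continuous_intros] =
  bounded_bilinear.continuous_on[OF bounded_bilinear_matrix_mult]

lemmas continuous_on_matrix_vector_mult [continuous_intros] =
  bounded_bilinear.continuous_on[OF bounded_bilinear_matrix_vector_mult]

lemma continuous_on_cdot [continuous_intros]:
  "continuous_on S f \<Longrightarrow> continuous_on S g \<Longrightarrow> continuous_on S (\<lambda>x. cdot (f x) (g x))"
  unfolding cdot_def by (intro continuous_intros)

lemma continuous_on_outer [continuous_intros]:
  "continuous_on S f \<Longrightarrow> continuous_on S g \<Longrightarrow> continuous_on S (\<lambda>x. outer (f x) (g x))"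
  unfolding outer_def by (intro continuous_intros)

lemma continuous_on_scalar_mult_vec [continuous_intros]:
  fixes f :: "_ \<Rightarrow> complex"
  shows "continuous_on S f \<Longrightarrow> continuous_on S g \<Longrightarrow> continuous_on S (\<lambda>x. f x *s g x)"
  unfolding vector_scalar_mult_def by (intro continuous_intros)

lemma borel_measurable_matrix_mult [measurable]:
  fixes F G :: "'a \<Rightarrow> complex^'n^'n"
  assumes "F \<in> borel_measurable M" "G \<in> borel_measurable M"
  shows "(\<lambda>z. F z ** G z) \<in> borel_measurable M"
  by (rule borel_measurable_continuous_Pair[OF assms]) (intro continuous_intros)

lemma borel_measurable_matrix_vector_mult [measurable]:
  fixes F :: "'a \<Rightarrow> complex^'n^'n"
  assumes "F \<in> borel_measurable M" "g \<in> borel_measurable M"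
  shows "(\<lambda>z. F z *v g z) \<in> borel_measurable M"
  by (rule borel_measurable_continuous_Pair[OF assms]) (intro continuous_intros)

lemma borel_measurable_outer [measurable]:
  assumes "f \<in> borel_measurable M" "g \<in> borel_measurable M"
  shows "(\<lambda>z. outer (f z) (g z)) \<in> borel_measurable M"
  by (rule borel_measurable_continuous_Pair[OF assms]) (intro continuous_intros)

text \<open>Only boundedness matters later, so the crude estimate through the sum of all entries is
  enough.\<close>

lemma norm_matrix_le:
  fixes X :: "complex^'n^'m"
  assumes "\<And>i j. cmod (X $ i $ j) \<le> c"
  shows "norm X \<le> real CARD('m) * real CARD('n) * c"
proof -
  have "norm X \<le> (\<Sum>i\<in>UNIV. \<Sum>j\<in>UNIV. norm (X $ i $ j))"
    unfolding norm_vec_def[of X] norm_vec_def[of "X $ _"]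
    by (intro order.trans[OF L2_set_le_sum] sum_mono) (auto simp: L2_set_nonneg)
  also have "\<dots> \<le> (\<Sum>i\<in>(UNIV::'m set). \<Sum>j\<in>(UNIV::'n set). c)"
    by (intro sum_mono assms)
  finally show ?thesis by (simp add: mult.assoc)
qed

lemma norm_outer_self:
  fixes v :: "complex^'n"
  assumes "norm v \<le> 1"
  shows "norm (outer v v) \<le> real CARD('n) * real CARD('n) * 1"
proof (rule norm_matrix_le)
  fix i j
  have "norm (v $ i) \<le> 1" "norm (v $ j) \<le> 1"
    using Finite_Cartesian_Product.norm_nth_le[of v] assms by (meson order.trans)+
  then show "norm (outer v v $ i $ j) \<le> 1" by (simp add: outer_def norm_mult mult_le_one)
qed

text \<open>The index of least code among those satisfying \<open>P k z\<close> depends measurably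
  on \<open>z\<close>; where none exists the value is irrelevant.\<close>

lemma measurable_choice_countable:
  fixes P :: "'k::countable \<Rightarrow> 'a \<Rightarrow> bool"
  assumes [measurable]: "\<And>k. Measurable.pred M (P k)"
  shows "\<exists>f \<in> measurable M (count_space UNIV). \<forall>z. (\<exists>k. P k z) \<longrightarrow> P (f z) z"
proof (intro bexI[of _ "\<lambda>z. from_nat (LEAST m. P (from_nat m) z)"] allI impI)
  fix z assume "\<exists>k. P k z"
  then show "P (from_nat (LEAST m. P (from_nat m) z)) z"
    by (metis (mono_tags, lifting) LeastI from_nat_to_nat)
next
  have "(\<lambda>z. LEAST m. P (from_nat m) z) \<in> measurable M (count_space UNIV)"
    by measurable
  then show "(\<lambda>z. from_nat (LEAST m. P (from_nat m) z) :: 'k) \<in> measurable M (count_space UNIV)"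
    by (rule measurable_compose) simp
qed

lemma AE_bounded_matrix_mult:
  fixes F G :: "'a \<Rightarrow> complex^'n^'n"
  assumes "\<exists>a. AE z in M. norm (F z) \<le> a" "\<exists>b. AE z in M. norm (G z) \<le> b"
  shows "\<exists>c. AE z in M. norm (F z ** G z) \<le> c"
proof -
  obtain K where K: "K > 0" "\<forall>(X :: complex^'n^'n) (Y :: complex^'n^'n). norm (X ** Y) \<le> norm X * norm Y * K"
    using bounded_bilinear.pos_bounded[OF bounded_bilinear_matrix_mult[where 'n='n]] by (elim exE conjE)
  obtain a b where "AE z in M. norm (F z) \<le> a" "AE z in M. norm (G z) \<le> b" using assms by blast
  then have "AE z in M. norm (F z ** G z) \<le> a * b * K"
  proof eventually_elim
    case (elim z)
    have "norm (F z) * norm (G z) * K \<le> a * b * K"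
      using elim K(1) by (intro mult_right_mono mult_mono) (auto intro: order_trans[OF norm_ge_zero])
    then show ?case using K(2) order.trans by blast
  qed
  then show ?thesis ..
qed

text \<open>Take the \<open>v i\<close> as columns of \<open>V\<close> and the conjugated
  \<open>w i\<close> as rows of \<open>W\<close>. Then V W = 1, so W V = 1 for these square
  matrices; if \<open>R j\<close> were zero, \<open>v j\<close> could be chosen zero and the (j, j)
  entry of W V would vanish.\<close>

lemma sum_outer_eq_one_nonzero:
  fixes R :: "'n::finite \<Rightarrow> complex^'n^'n"
  assumes R: "\<And>i. \<exists>v w. R i = outer v w" and sum: "(\<Sum>i\<in>UNIV. R i) = mat 1"
  shows "R j \<noteq> 0"
proof
  assume "R j = 0"
  have "\<forall>i. \<exists>v w. R i = outer v w \<and> (i = j \<longrightarrow> v = 0)"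
  proof
    fix i show "\<exists>v w. R i = outer v w \<and> (i = j \<longrightarrow> v = 0)"
      using R[of i] \<open>R j = 0\<close> by (cases "i = j") (auto intro!: exI[of _ 0])
  qed
  then obtain v w where vw: "\<And>i. R i = outer (v i) (w i)" "v j = 0" by metis
  define V where "V = (\<chi> a i. v i $ a)"
  define W where "W = (\<chi> i b. cnj (w i $ b))"
  have "V ** W = mat 1"
    unfolding sum[symmetric] by (simp add: vw V_def W_def vec_eq_iff matrix_matrix_mult_def outer_def)
  then have "W ** V = mat 1" by (simp add: matrix_left_right_inverse)
  moreover have "(W ** V) $ j $ j = 0" using vw(2) by (simp add: matrix_matrix_mult_def V_def)
  ultimately show False by (simp add: mat_def)
qed

text \<open>When position \<open>j\<close> is empty, the part of \<open>E i\<close> cut out by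
  \<open>Q\<close> stays at \<open>i\<close> and the remainder moves to \<open>j\<close>;
  orthogonality survives because \<open>Q\<close> commutes with every \<open>E k\<close>.\<close>

lemma split_orthogonal_idempotents:
  fixes E :: "'n::finite \<Rightarrow> complex^'n^'n"
  assumes orth: "\<And>k l. k \<noteq> l \<Longrightarrow> E k ** E l = 0" and sum: "(\<Sum>k\<in>UNIV. E k) = mat 1"
    and Ei: "E i ** E i = E i" and Q: "Q ** Q = Q" "\<And>k. Q ** E k = E k ** Q"
    and ij: "i \<noteq> j" "E j = 0"
  defines "E' \<equiv> E(i := Q ** E i, j := E i - Q ** E i)"
  shows "k \<noteq> l \<Longrightarrow> E' k ** E' l = 0" "(\<Sum>k\<in>UNIV. E' k) = mat 1"
proof -
  assume kl: "k \<noteq> l"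
  have *: "X ** (Q ** Y) = Q ** (X ** Y)" if "X \<in> range E" for X Y
    using that Q(2) by (metis (no_types, lifting) matrix_mul_assoc rangeE)
  have **: "Q ** (Q ** Y) = Q ** Y" for Y using Q(1) by (simp add: matrix_mul_assoc)
  show "E' k ** E' l = 0"
    using kl ij by (auto simp: E'_def matrix_diff_ldistrib matrix_diff_rdistrib orth * ** Ei matrix_mul_assoc[symmetric])
next
  have "(\<Sum>k\<in>UNIV. E' k) = (\<Sum>k\<in>UNIV - {i, j}. E' k) + (\<Sum>k\<in>{i, j}. E' k)"
    by (rule sum.subset_diff) auto
  also have "(\<Sum>k\<in>UNIV - {i, j}. E' k) = (\<Sum>k\<in>UNIV - {i, j}. E k)"
    by (intro sum.cong) (auto simp: E'_def)
  also have "(\<Sum>k\<in>{i, j}. E' k) = (\<Sum>k\<in>{i, j}. E k)" using ij by (simp add: E'_def)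
  also have "(\<Sum>k\<in>UNIV - {i, j}. E k) + (\<Sum>k\<in>{i, j}. E k) = (\<Sum>k\<in>UNIV. E k)"
    by (rule sum.subset_diff[symmetric]) auto
  finally show "(\<Sum>k\<in>UNIV. E' k) = mat 1" using sum by simp
qed

text \<open>The selection is applied to the compact sets of unit eigenvectors of \<open>A z\<close>
  fixed by \<open>E z\<close>, which are zero sets of a function continuous in the vector.\<close>

lemma exists_measurable_eigenvector:
  fixes A E :: "'a \<Rightarrow> complex^'n^'n"
  assumes [measurable]: "A \<in> borel_measurable M" "E \<in> borel_measurable M"
  shows "\<exists>v \<in> borel_measurable M. \<forall>z\<in>space M. norm (v z) \<le> 1 \<and>
    (A z ** E z = E z ** A z \<and> E z ** E z = E z \<and> E z \<noteq> 0 \<longrightarrow>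
      norm (v z) = 1 \<and> E z *v v z = v z \<and> (\<exists>l. A z *v v z = l *s v z))"
proof -
  \<comment> \<open>A unit eigenvector has eigenvalue \<open>cdot (A z *v v) v\<close>; inserting it
    removes the quantifier over \<open>l\<close>.\<close>
  define g where "g = (\<lambda>z v. norm (E z *v v - v) + norm (A z *v v - cdot (A z *v v) v *s v))"
  have g_cont: "continuous_on S (g z)" for S z
    unfolding g_def by (intro continuous_intros)
  have g_meas: "(\<lambda>z. g z v) \<in> borel_measurable M" for v
  proof -
    have [measurable]: "(\<lambda>z. cdot (A z *v v) v *s v) \<in> borel_measurable M"
      by (rule borel_measurable_continuous_on[of "\<lambda>X. cdot (X *v v) v *s v"]) (intro continuous_intros, simp)
    show ?thesis unfolding g_def by measurable
  qed
  define K where "K = (\<lambda>z. {v \<in> sphere 0 1. g z v = 0})"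
  \<comment> \<open>Points without such a vector receive the set {0}, so that the selection is
    defined everywhere; hence only \<open>norm (v z) \<le> 1\<close> in general.\<close>
  define K' where "K' = (\<lambda>z. if K z = {} then {0} else K z)"
  have cK: "compact (K z)" for z
  proof -
    have "K z = sphere 0 1 \<inter> {v. g z v = 0}" by (auto simp: K_def)
    moreover have "closed {v. g z v = 0}"
      by (intro closed_Collect_eq g_cont continuous_intros)
    ultimately show ?thesis by (simp add: compact_Int_closed)
  qed
  have mK: "{z \<in> space M. K z \<inter> C \<noteq> {}} \<in> sets M" if "closed C" for C
  proof -
    have "{z \<in> space M. K z \<inter> C \<noteq> {}} = {z \<in> space M. \<exists>v\<in>sphere 0 1 \<inter> C. g z v = 0}"
      by (auto simp: K_def)
    also have "\<dots> \<in> sets M"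
      by (intro sets_Collect_zero_on_compact g_meas g_cont compact_Int_closed compact_sphere that)
        (simp add: g_def)
    finally show ?thesis .
  qed
  have mK': "{z \<in> space M. K' z \<inter> C \<noteq> {}} \<in> sets M" if "closed C" for C
  proof -
    have "{z \<in> space M. K' z \<inter> C \<noteq> {}} =
      {z \<in> space M. K z \<inter> C \<noteq> {}} \<union> (if 0 \<in> C then space M - {z \<in> space M. K z \<inter> UNIV \<noteq> {}} else {})"
      by (auto simp: K'_def)
    also have "\<dots> \<in> sets M" using mK[OF that] mK[OF closed_UNIV] by auto
    finally show ?thesis .
  qed
  have "compact (K' z) \<and> K' z \<noteq> {}" for z using cK by (simp add: K'_def)
  then obtain v where v: "v \<in> borel_measurable M" "\<And>z. z \<in> space M \<Longrightarrow> v z \<in> K' z"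
    using measurable_selection_compact[of M K'] mK' by blast
  show ?thesis
  proof (intro bexI[OF _ v(1)] ballI conjI impI)
    fix z assume z: "z \<in> space M"
    show "norm (v z) \<le> 1" using v(2)[OF z] by (auto simp: K'_def K_def split: if_splits)
    assume "A z ** E z = E z ** A z \<and> E z ** E z = E z \<and> E z \<noteq> 0"
    then obtain w l where w: "norm w = 1" "E z *v w = w" "A z *v w = l *s w"
      using eigenvector_in_range_of_commuting_idempotent[of "A z" "E z"] by blast
    have "cdot (l *s w) w = l * cdot w w" by (simp add: cdot_def sum_distrib_left mult.assoc)
    then have "w \<in> K z" using w by (simp add: K_def g_def cdot_self)
    then have vz: "v z \<in> K z" using v(2)[OF z] by (auto simp: K'_def split: if_splits)
    then show "norm (v z) = 1" "E z *v v z = v z" "\<exists>l. A z *v v z = l *s v z"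
      by (auto simp: K_def g_def add_nonneg_eq_0_iff intro!: exI[of _ "cdot (A z *v v z) (v z)"])
  qed
qed

section \<open>Maximal abelian families of idempotent matrix functions\<close>

text \<open>The fibrewise form of a bounded maximal abelian set: operators become functions, and
  operator equations become equations almost everywhere. The bound \<open>c\<close> in
  \<open>maximal\<close> is arbitrary, whereas all members share the bound \<open>C\<close>.\<close>

locale max_abelian = finite_measure M for M :: "'a measure" +
  fixes A :: "'a \<Rightarrow> complex^'n^'n" and PP :: "('a \<Rightarrow> complex^'n^'n) set" and C :: real
  assumes A_meas [measurable]: "A \<in> borel_measurable M"
    and A_normal: "AE z in M. A z ** adjm (A z) = adjm (A z) ** A z"
    and meas: "G \<in> PP \<Longrightarrow> G \<in> borel_measurable M"
    and bound: "G \<in> PP \<Longrightarrow> AE z in M. norm (G z) \<le> C"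
    and idem: "G \<in> PP \<Longrightarrow> AE z in M. G z ** G z = G z"
    and comm_A: "G \<in> PP \<Longrightarrow> AE z in M. A z ** G z = G z ** A z"
    and comm: "G \<in> PP \<Longrightarrow> H \<in> PP \<Longrightarrow> AE z in M. G z ** H z = H z ** G z"
    and maximal: "R \<in> borel_measurable M \<Longrightarrow> AE z in M. norm (R z) \<le> c \<Longrightarrow>
      AE z in M. R z ** R z = R z \<Longrightarrow> AE z in M. A z ** R z = R z ** A z \<Longrightarrow>
      (\<And>G. G \<in> PP \<Longrightarrow> AE z in M. G z ** R z = R z ** G z) \<Longrightarrow> R \<in> PP"
begin

text \<open>Countably many null sets have a null union, so off one null set the relations hold for
  all \<open>k\<close>, and thus at the index \<open>m z\<close>. The common bound \<open>C\<close>
  keeps the result bounded.\<close>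

lemma glue:
  fixes G :: "nat \<Rightarrow> 'a \<Rightarrow> complex^'n^'n"
  assumes m: "m \<in> measurable M (count_space UNIV)" and G: "\<And>k. G k \<in> PP"
  shows "(\<lambda>z. G (m z) z) \<in> PP"
proof (rule maximal)
  show "(\<lambda>z. G (m z) z) \<in> borel_measurable M"
    by (rule measurable_compose_countable[OF meas[OF G] m])
  have "AE z in M. \<forall>k. norm (G k z) \<le> C" using bound[OF G] by (simp add: AE_all_countable)
  then show "AE z in M. norm (G (m z) z) \<le> C" by eventually_elim simp
  have "AE z in M. \<forall>k. G k z ** G k z = G k z" using idem[OF G] by (simp add: AE_all_countable)
  then show "AE z in M. G (m z) z ** G (m z) z = G (m z) z" by eventually_elim simp
  have "AE z in M. \<forall>k. A z ** G k z = G k z ** A z" using comm_A[OF G] by (simp add: AE_all_countable)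
  then show "AE z in M. A z ** G (m z) z = G (m z) z ** A z" by eventually_elim simp
  fix H assume "H \<in> PP"
  then have "AE z in M. \<forall>k. H z ** G k z = G k z ** H z" using comm[OF _ G] by (simp add: AE_all_countable)
  then show "AE z in M. H z ** G (m z) z = G (m z) z ** H z" by eventually_elim simp
qed

lemma if_mem:
  assumes [measurable]: "S \<in> sets M" and "G \<in> PP" "H \<in> PP"
  shows "(\<lambda>z. if z \<in> S then G z else H z) \<in> PP"
proof -
  have "(\<lambda>z. (\<lambda>k. if k = 0 then G else H) (if z \<in> S then 0 else 1 :: nat) z) \<in> PP"
    by (rule glue) (use assms in auto)
  then show ?thesis by (rule back_subst[of "\<lambda>X. X \<in> PP"]) auto
qed

lemma zero_mem: "(\<lambda>z. 0) \<in> PP"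
  by (rule maximal[of _ 0]) auto

lemma one_mem: "(\<lambda>z. mat 1) \<in> PP"
  by (rule maximal[of _ "norm (mat 1 :: complex^'n^'n)"]) auto

lemma mult_mem:
  assumes G: "G \<in> PP" and H: "H \<in> PP"
  shows "(\<lambda>z. G z ** H z) \<in> PP"
proof -
  obtain c where c: "AE z in M. norm (G z ** H z) \<le> c"
    using AE_bounded_matrix_mult bound[OF G] bound[OF H] by blast
  show ?thesis
  proof (rule maximal)
    show "AE z in M. norm (G z ** H z) \<le> c" by fact
    show "AE z in M. (G z ** H z) ** (G z ** H z) = G z ** H z"
      using comm[OF G H] idem[OF G] idem[OF H] by eventually_elim (metis matrix_mul_assoc)
    show "AE z in M. A z ** (G z ** H z) = (G z ** H z) ** A z"
      using comm_A[OF G] comm_A[OF H] by eventually_elim (metis matrix_mul_assoc)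
    show "AE z in M. F z ** (G z ** H z) = (G z ** H z) ** F z" if "F \<in> PP" for F
      using comm[OF that G] comm[OF that H] by eventually_elim (metis matrix_mul_assoc)
  qed (intro borel_measurable_matrix_mult meas G H)
qed

text \<open>Commutation turns \<open>le\<close> into H G = H almost everywhere, which makes G - H
  idempotent.\<close>

lemma diff_mem:
  assumes G: "G \<in> PP" and H: "H \<in> PP" and le: "AE z in M. G z ** H z = H z"
  shows "(\<lambda>z. G z - H z) \<in> PP"
proof -
  note [measurable] = meas[OF G] meas[OF H]
  show ?thesis
  proof (rule maximal)
    show "AE z in M. norm (G z - H z) \<le> C + C"
      using bound[OF G] bound[OF H] by eventually_elim (meson add_mono norm_triangle_ineq4 order.trans)
    show "AE z in M. (G z - H z) ** (G z - H z) = G z - H z"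
      using comm[OF G H] idem[OF G] idem[OF H] le
      by eventually_elim (simp add: matrix_diff_ldistrib matrix_diff_rdistrib)
    show "AE z in M. A z ** (G z - H z) = (G z - H z) ** A z"
      using comm_A[OF G] comm_A[OF H] 
      by eventually_elim (simp add: matrix_diff_ldistrib matrix_diff_rdistrib)
    show "AE z in M. F z ** (G z - H z) = (G z - H z) ** F z" if "F \<in> PP" for F
      using comm[OF that G] comm[OF that H]
      by eventually_elim (simp add: matrix_diff_ldistrib matrix_diff_rdistrib)
  qed (intro borel_measurable_diff meas G H)
qed

text \<open>Where \<open>E z\<close> is nonzero, \<open>R z\<close> is \<open>E z\<close> followed
  by the orthogonal projection onto a measurable unit eigenvector in its range. Whether
  \<open>R\<close> commutes with \<open>PP\<close>, and so belongs to it, is left open here.\<close>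

lemma exists_rank_one_below:
  assumes E: "E \<in> PP"
  shows "\<exists>R \<in> borel_measurable M. \<exists>c. AE z in M. norm (R z) \<le> c \<and> R z ** R z = R z \<and>
    E z ** R z = R z \<and> R z ** E z = R z \<and> A z ** R z = R z ** A z \<and>
    (\<exists>v w. R z = outer v w) \<and> (E z \<noteq> 0 \<longrightarrow> R z \<noteq> 0)"
proof -
  note [measurable] = meas[OF E]
  obtain v where [measurable]: "v \<in> borel_measurable M" and
    v: "\<And>z. z \<in> space M \<Longrightarrow> norm (v z) \<le> 1 \<and>
    (A z ** E z = E z ** A z \<and> E z ** E z = E z \<and> E z \<noteq> 0 \<longrightarrow>
      norm (v z) = 1 \<and> E z *v v z = v z \<and> (\<exists>l. A z *v v z = l *s v z))"
    using exists_measurable_eigenvector[OF A_meas meas[OF E]] by blast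
  have "AE z in M. norm (outer (v z) (v z)) \<le> real CARD('n) * real CARD('n) * 1"
    using AE_space by eventually_elim (use v norm_outer_self in blast)
  from AE_bounded_matrix_mult[OF exI exI, OF this bound[OF E]]
  obtain c where c: "AE z in M. norm (outer (v z) (v z) ** E z) \<le> c" ..
  show ?thesis
  proof (intro bexI[of _ "\<lambda>z. outer (v z) (v z) ** E z"] exI[of _ c])
    show "AE z in M. norm (outer (v z) (v z) ** E z) \<le> c \<and>
      (outer (v z) (v z) ** E z) ** (outer (v z) (v z) ** E z) = outer (v z) (v z) ** E z \<and>
      E z ** (outer (v z) (v z) ** E z) = outer (v z) (v z) ** E z \<and>
      (outer (v z) (v z) ** E z) ** E z = outer (v z) (v z) ** E z \<and>
      A z ** (outer (v z) (v z) ** E z) = (outer (v z) (v z) ** E z) ** A z \<and>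
      (\<exists>x w. outer (v z) (v z) ** E z = outer x w) \<and> (E z \<noteq> 0 \<longrightarrow> outer (v z) (v z) ** E z \<noteq> 0)"
      using c idem[OF E] comm_A[OF E] A_normal AE_space
    proof eventually_elim
      case (elim z)
      have ow: "\<exists>x w. outer (v z) (v z) ** E z = outer x w" using outer_matrix_mult by blast
      show ?case
      proof (cases "E z = 0")
        case False
        then obtain l where l: "norm (v z) = 1" "E z *v v z = v z" "A z *v v z = l *s v z"
          using v[OF elim(5)] elim by blast
        note r = rank_one_subidempotent[OF elim(4,3,2) l]
        have "outer (v z) (v z) ** E z \<noteq> 0" using r(5) l(1) by (metis matrix_vector_mult_0 norm_zero zero_neq_one)
        then show ?thesis using r(1-4) elim(1) ow by blast
      qed (use elim(1) in \<open>auto intro!: exI[of _ 0]\<close>)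
    qed
  qed measurable
qed

end

section \<open>Resolutions of the identity within the family\<close>

context max_abelian
begin

text \<open>Members may vanish: an empty position is where one half of a split idempotent can be
  placed, and the identity padded with zeros is a starting point.\<close>

definition resolutions :: "('n \<Rightarrow> 'a \<Rightarrow> complex^'n^'n) set" where
  "resolutions = {E. (\<forall>i. E i \<in> PP) \<and>
    (AE z in M. (\<forall>i j. i \<noteq> j \<longrightarrow> E i z ** E j z = 0) \<and> (\<Sum>i\<in>UNIV. E i z) = mat 1)}"

definition mass :: "('n \<Rightarrow> 'a \<Rightarrow> complex^'n^'n) \<Rightarrow> real" where
  "mass E = (\<integral>z. real (card {i. E i z \<noteq> 0}) \<partial>M)"

lemma card_nonzero_measurable:
  fixes E :: "'n \<Rightarrow> 'a \<Rightarrow> complex^'n^'n"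
  assumes "\<And>i. E i \<in> PP"
  shows "(\<lambda>z. card {i. E i z \<noteq> 0}) \<in> measurable M (count_space UNIV)"
proof -
  note [measurable] = meas[OF assms]
  have "(\<lambda>z. card {i. E i z \<noteq> 0}) = (\<lambda>z. \<Sum>i\<in>UNIV. if E i z = 0 then 0 else 1)"
    by (simp add: sum.If_cases Collect_neg_eq)
  also have "\<dots> \<in> measurable M (count_space UNIV)"
    by measurable
  finally show ?thesis .
qed

lemma card_nonzero_integrable:
  fixes E :: "'n \<Rightarrow> 'a \<Rightarrow> complex^'n^'n"
  assumes "\<And>i. E i \<in> PP"
  shows "integrable M (\<lambda>z. real (card {i. E i z \<noteq> 0}))"
proof (rule integrable_const_bound[of _ "real CARD('n)"])
  show "AE z in M. norm (real (card {i. E i z \<noteq> 0})) \<le> real CARD('n)"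
    by (auto intro!: card_mono)
  show "(\<lambda>z. real (card {i. E i z \<noteq> 0})) \<in> borel_measurable M"
    using measurable_compose[OF card_nonzero_measurable[OF assms], of real borel] by simp
qed

text \<open>Suppose no \<open>Q\<close> splits any \<open>E i\<close> where some \<open>E j\<close>
  vanishes. Then the idempotent \<open>R i\<close> of rank at most one below \<open>E i\<close>
  commutes with \<open>PP\<close> there, lies in \<open>PP\<close> after cutting off, and, as it
  does not split \<open>E i\<close>, equals it. But n matrices of rank at most one that sum to the
  identity are all nonzero, a contradiction.\<close>

lemma exists_splitting:
  assumes E: "E \<in> resolutions" and bad: "\<not> (AE z in M. \<forall>j. E j z \<noteq> 0)"
  shows "\<exists>i j. \<exists>Q\<in>PP. \<not> (AE z in M. \<not> (E j z = 0 \<and> Q z ** E i z \<noteq> 0 \<and> Q z ** E i z \<noteq> E i z))"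
proof (rule ccontr)
  assume "\<not> ?thesis"
  then have nosplit: "AE z in M. E j z = 0 \<longrightarrow> Q z ** E i z = 0 \<or> Q z ** E i z = E i z" if "Q \<in> PP" for Q i j
    using that by auto
  have EP: "E i \<in> PP" for i using E by (simp add: resolutions_def)
  note [measurable] = meas[OF EP]
  define below where "below = (\<lambda>i c R. AE z in M. norm (R z) \<le> c \<and> R z ** R z = R z \<and>
    E i z ** R z = R z \<and> R z ** E i z = R z \<and> A z ** R z = R z ** A z \<and>
    (\<exists>v w. R z = outer v w) \<and> (E i z \<noteq> 0 \<longrightarrow> R z \<noteq> 0))"
  have "\<forall>i. \<exists>R\<in>borel_measurable M. \<exists>c. below i c R"
    using exists_rank_one_below[OF EP] unfolding below_def by blast
  then obtain R c where [measurable]: "\<And>i. R i \<in> borel_measurable M" and R': "\<And>i. below i (c i) (R i)"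
    by metis
  note R = R'[unfolded below_def]
  have "AE z in M. E j z = 0 \<longrightarrow> E i z = R i z" for i j
  proof -
    define S where "S = {z \<in> space M. E j z = 0}"
    have S: "S \<in> sets M" unfolding S_def by measurable
    \<comment> \<open>Outside \<open>S\<close> nothing is known about commutation of
      \<open>R i\<close> with \<open>PP\<close>; the value 0 makes \<open>T\<close> commute
      there.\<close>
    define T where "T = (\<lambda>z. if z \<in> S then R i z else 0)"
    have T_meas: "T \<in> borel_measurable M" unfolding T_def using S by measurable
    have c0: "AE z in M. norm (T z) \<le> max 0 (c i)"
      using R[of i] by eventually_elim (auto simp: T_def)
    have TP: "T \<in> PP"
    proof (rule maximal[OF T_meas c0])
      show "AE z in M. T z ** T z = T z" using R[of i] by eventually_elim (auto simp: T_def)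
      show "AE z in M. A z ** T z = T z ** A z" using R[of i] by eventually_elim (auto simp: T_def)
      fix Q assume Q: "Q \<in> PP"
      show "AE z in M. Q z ** T z = T z ** Q z"
        using R[of i] nosplit[OF Q, of j i] comm[OF Q EP[of i]]
      proof eventually_elim
        case (elim z)
        show ?case
        proof (cases "z \<in> S")
          case True
          then have "Q z ** E i z = 0 \<or> Q z ** E i z = E i z" using elim(2) by (simp add: S_def)
          \<comment> \<open>Since \<open>R i z\<close> lies below \<open>E i z\<close> on both
            sides, only \<open>Q z ** E i z\<close> matters: it is 0 or \<open>E i z\<close>, so
            both products are 0 or both are \<open>R i z\<close>.\<close>
          moreover have "Q z ** R i z = (Q z ** E i z) ** R i z" "R i z ** Q z = R i z ** (Q z ** E i z)"
            using elim(1,3) by (metis matrix_mul_assoc)+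
          ultimately show ?thesis using True elim(1) by (auto simp: T_def)
        qed (simp add: T_def)
      qed
    qed
    \<comment> \<open>The assumption is now applied to \<open>T\<close> itself. On \<open>S\<close>
      it leaves \<open>R i z = 0\<close> or \<open>R i z = E i z\<close>, and the first also forces
      \<open>E i z = 0\<close>.\<close>
    show ?thesis
      using R[of i] nosplit[OF TP, of j i] AE_space
    proof eventually_elim
      case (elim z)
      show ?case
      proof
        assume "E j z = 0"
        then have "T z = R i z" using elim(3) by (simp add: T_def S_def)
        then have "R i z = 0 \<or> R i z = E i z" using elim \<open>E j z = 0\<close> by simp
        then show "E i z = R i z" using elim(1) by auto
      qed
    qed
  qed
  then have "AE z in M. \<forall>i j. E j z = 0 \<longrightarrow> E i z = R i z" unfolding AE_all_countable by blast
  moreover have "AE z in M. \<forall>i. \<exists>v w. R i z = outer v w"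
    using R by (auto simp: AE_all_countable elim!: eventually_mono)
  moreover have "AE z in M. (\<Sum>i\<in>UNIV. E i z) = mat 1" using E by (simp add: resolutions_def)
  ultimately have "AE z in M. \<forall>j. E j z \<noteq> 0"
  proof eventually_elim
    case (elim z)
    show ?case
    proof (intro allI notI)
      fix j assume "E j z = 0"
      then have "E i z = R i z" for i using elim(1) by blast
      then have "R j z \<noteq> 0" "E j z = R j z"
        using sum_outer_eq_one_nonzero[of "\<lambda>i. R i z" j] elim(2,3) by auto
      then show False using \<open>E j z = 0\<close> by simp
    qed
  qed
  then show False using bad by simp
qed

text \<open>On the set \<open>S\<close>, of positive measure, where \<open>Q\<close> splits
  \<open>E i\<close> and position \<open>j\<close> is empty, both halves are nonzero, so
  distributing them over \<open>i\<close> and \<open>j\<close> raises the number of nonzero members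
  by one.\<close>

lemma improve_resolution:
  assumes E: "E \<in> resolutions" and bad: "\<not> (AE z in M. \<forall>j. E j z \<noteq> 0)"
  shows "\<exists>E'\<in>resolutions. mass E < mass E'"
proof -
  have EP: "E i \<in> PP" for i using E by (simp add: resolutions_def)
  obtain i j Q where Q: "Q \<in> PP"
    and split: "\<not> (AE z in M. \<not> (E j z = 0 \<and> Q z ** E i z \<noteq> 0 \<and> Q z ** E i z \<noteq> E i z))"
    using exists_splitting[OF assms] by blast
  note [measurable] = meas[OF EP] meas[OF Q]
  \<comment> \<open>For \<open>i = j\<close> the vanishing of \<open>E j z\<close> would force
    \<open>Q z ** E i z = 0\<close>.\<close>
  have ij: "i \<noteq> j"
  proof
    assume "i = j"
    then have "AE z in M. \<not> (E j z = 0 \<and> Q z ** E i z \<noteq> 0 \<and> Q z ** E i z \<noteq> E i z)" by simp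
    then show False using split by simp
  qed
  define S where "S = {z \<in> space M. E j z = 0 \<and> Q z ** E i z \<noteq> 0 \<and> Q z ** E i z \<noteq> E i z}"
  have S: "S \<in> sets M" unfolding S_def by measurable
  have "emeasure M S \<noteq> 0"
    using split S unfolding S_def by (subst (asm) AE_iff_measurable[OF _ refl]) auto
  then have S_pos: "0 < measure M S" by (simp add: emeasure_eq_measure measure_nonneg less_le)
  define E' where "E' = E(i := (\<lambda>z. if z \<in> S then Q z ** E i z else E i z),
    j := (\<lambda>z. if z \<in> S then E i z - Q z ** E i z else E j z))"
  have le: "AE z in M. E i z ** (Q z ** E i z) = Q z ** E i z"
    using comm[OF Q EP[of i]] idem[OF EP[of i]] by eventually_elim (metis matrix_mul_assoc)
  have E'P: "E' k \<in> PP" for k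
    unfolding E'_def using S ij by (auto intro!: if_mem mult_mem diff_mem Q EP le)
  have E'z: "(\<lambda>k. E' k z) = (if z \<in> S then (\<lambda>k. E k z)(i := Q z ** E i z, j := E i z - Q z ** E i z) else (\<lambda>k. E k z))" for z
    by (auto simp: E'_def fun_eq_iff)
  have "AE z in M. (\<forall>i j. i \<noteq> j \<longrightarrow> E i z ** E j z = 0) \<and> (\<Sum>i\<in>UNIV. E i z) = mat 1"
    using E by (simp add: resolutions_def)
  moreover have "AE z in M. \<forall>k. Q z ** E k z = E k z ** Q z"
    using comm[OF Q EP] by (simp add: AE_all_countable)
  ultimately have "AE z in M. (\<forall>k l. k \<noteq> l \<longrightarrow> E' k z ** E' l z = 0) \<and> (\<Sum>k\<in>UNIV. E' k z) = mat 1"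
    using idem[OF EP[of i]] idem[OF Q]
  proof eventually_elim
    case (elim z)
    show ?case
    proof (cases "z \<in> S")
      case True
      then have "E j z = 0" by (simp add: S_def)
      note * = split_orthogonal_idempotents[of "\<lambda>k. E k z" i "Q z" j]
      have "E' k z = ((\<lambda>k. E k z)(i := Q z ** E i z, j := E i z - Q z ** E i z)) k" for k
        using fun_cong[OF E'z[of z], of k] True by simp
      then show ?thesis using *(1) *(2) elim ij \<open>E j z = 0\<close> by simp
    next
      case False
      then have "E' k z = E k z" for k using fun_cong[OF E'z[of z], of k] by simp
      then show ?thesis using elim by simp
    qed
  qed
  then have E': "E' \<in> resolutions" using E'P by (simp add: resolutions_def)
  have card: "real (card {k. E' k z \<noteq> 0}) = real (card {k. E k z \<noteq> 0}) + indicator S z" for z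
  proof (cases "z \<in> S")
    case True
    then have z: "E j z = 0" "Q z ** E i z \<noteq> 0" "Q z ** E i z \<noteq> E i z" by (auto simp: S_def)
    then have "E i z \<noteq> 0" by auto
    have "{k. E' k z \<noteq> 0} = insert j {k. E k z \<noteq> 0}"
      using True z \<open>E i z \<noteq> 0\<close> ij by (auto simp: E'_def)
    then show ?thesis using True z by simp
  next
    case False
    then have "E' k z = E k z" for k using fun_cong[OF E'z[of z], of k] by simp
    then show ?thesis using False by simp
  qed
  have "mass E' = mass E + measure M S"
    unfolding mass_def card using S card_nonzero_integrable[OF EP]
    by (subst Bochner_Integration.integral_add) (auto simp: emeasure_eq_measure)
  then have "mass E < mass E'" using S_pos by linarith
  then show ?thesis using E' by blast
qed

text \<open>The supremum of \<open>mass\<close> is attained by the pointwise best gluing of a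
  maximizing sequence, and \<open>improve_resolution\<close> excludes vanishing members at a
  maximum.\<close>

lemma exists_full_resolution: "\<exists>E\<in>resolutions. AE z in M. \<forall>j. E j z \<noteq> 0"
proof -
  have mass_le: "mass E \<le> real CARD('n) * measure M (space M)" if "E \<in> resolutions" for E
  proof -
    have "mass E \<le> (\<integral>z. real CARD('n) \<partial>M)"
      unfolding mass_def using that
      by (intro integral_mono card_nonzero_integrable) (auto simp: resolutions_def intro!: card_mono)
    then show ?thesis by (simp add: mult.commute)
  qed
  then have bdd: "bdd_above (mass ` resolutions)" by (auto intro!: bdd_aboveI)
  \<comment> \<open>An arbitrary position for the identity in the starting resolution.\<close>
  obtain i0 :: 'n where True by simp
  have "(\<lambda>i z. if i = i0 then mat 1 else 0) \<in> resolutions"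
  proof -
    have "(\<lambda>z. if i = i0 then mat 1 else 0) \<in> PP" for i
      using zero_mem one_mem by (cases "i = i0") auto
    then show ?thesis by (auto simp: resolutions_def)
  qed
  then have ne: "resolutions \<noteq> {}" by blast
  define s where "s = (SUP E\<in>resolutions. mass E)"
  have "\<exists>E\<in>resolutions. s - 1 / real (Suc m) < mass E" for m
    using less_cSUP_iff[OF ne bdd, of "s - 1 / real (Suc m)"] by (simp add: s_def)
  then obtain t where t: "\<And>m. t m \<in> resolutions" "\<And>m. s - 1 / real (Suc m) < mass (t m)" by metis
  have tP: "t m i \<in> PP" for m i using t(1) by (simp add: resolutions_def)
  define c where "c = (\<lambda>m z. card {i. t m i z \<noteq> 0})"
  have c_meas: "c m \<in> measurable M (count_space UNIV)" for m
    unfolding c_def by (rule card_nonzero_measurable[OF tP])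
  \<comment> \<open>The first index with the largest count at \<open>z\<close>. It exists although
    the sequence is infinite, because the counts are integers bounded by the dimension.\<close>
  define best where "best = (\<lambda>z. LEAST m. \<forall>k. c k z \<le> c m z)"
  have [measurable]: "(\<lambda>z. real (c m z)) \<in> borel_measurable M" for m
    using measurable_compose[OF c_meas, of real borel] by simp
  have "Measurable.pred M (\<lambda>z. \<forall>k. real (c k z) \<le> real (c m z))" for m by measurable
  then have best_meas: "best \<in> measurable M (count_space UNIV)"
    unfolding best_def of_nat_le_iff by (rule measurable_Least)
  have best: "c k z \<le> c (best z) z" for k z
  proof -
    have "c k z < Suc CARD('n)" for k by (auto simp: c_def less_Suc_eq_le intro!: card_mono)
    then have "\<exists>m. \<forall>k. c k z \<le> c m z"
      using ex_has_greatest_nat[of "\<lambda>_. True" 0 "\<lambda>k. c k z" "Suc CARD('n)"] by auto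
    then have "\<forall>k. c k z \<le> c (best z) z" unfolding best_def by (rule LeastI_ex)
    then show ?thesis by blast
  qed
  define E where "E = (\<lambda>i z. t (best z) i z)"
  have EP: "E i \<in> PP" for i unfolding E_def by (rule glue[OF best_meas tP])
  have "AE z in M. \<forall>m. (\<forall>i j. i \<noteq> j \<longrightarrow> t m i z ** t m j z = 0) \<and> (\<Sum>i\<in>UNIV. t m i z) = mat 1"
    using t(1) unfolding AE_all_countable by (simp add: resolutions_def)
  then have "AE z in M. (\<forall>i j. i \<noteq> j \<longrightarrow> E i z ** E j z = 0) \<and> (\<Sum>i\<in>UNIV. E i z) = mat 1"
    unfolding E_def by eventually_elim simp
  then have E: "E \<in> resolutions" using EP by (simp add: resolutions_def)
  \<comment> \<open>The count of \<open>E\<close> dominates that of every \<open>t m\<close>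
    pointwise, so its mass reaches the supremum.\<close>
  have "mass (t m) \<le> mass E" for m
    unfolding mass_def
    by (intro integral_mono card_nonzero_integrable tP EP) (use best in \<open>auto simp: c_def E_def\<close>)
  then have near: "s - 1 / real (Suc m) < mass E" for m using t(2)[of m] by (meson order.strict_trans2)
  have s: "s \<le> mass E"
  proof (rule ccontr)
    assume "\<not> ?thesis"
    then obtain m where "inverse (real (Suc m)) < s - mass E" using reals_Archimedean[of "s - mass E"] by auto
    with near[of m] show False by (simp add: inverse_eq_divide)
  qed
  have "AE z in M. \<forall>j. E j z \<noteq> 0"
  proof (rule ccontr)
    assume "\<not> ?thesis"
    then obtain E' where "E' \<in> resolutions" "mass E < mass E'" using improve_resolution[OF E] by blast
    moreover from this have "mass E' \<le> s" unfolding s_def by (intro cSUP_upper bdd)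
    ultimately show False using s by simp
  qed
  then show ?thesis using E by blast
qed

end

section \<open>Measurable diagonalization\<close>

definition diagm :: "complex^'n^'n \<Rightarrow> bool" where
  "diagm X \<longleftrightarrow> (\<forall>i j. i \<noteq> j \<longrightarrow> X $ i $ j = 0)"

lemma diagm_commute:
  fixes X Y :: "complex^'n^'n"
  assumes "diagm X" "diagm Y"
  shows "X ** Y = Y ** X"
proof -
  have "(X ** Y) $ i $ j = (if i = j then X $ i $ i * Y $ i $ i else 0)" if "diagm X" "diagm Y" for X Y :: "complex^'n^'n" and i j
  proof -
    have "(X ** Y) $ i $ j = (\<Sum>k\<in>{i}. X $ i $ k * Y $ k $ j)"
      unfolding matrix_matrix_mult_def
      using that(1) by (simp add: diagm_def) (rule sum.mono_neutral_right[of UNIV "{i}", simplified]; auto)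
    then show ?thesis using that(2) by (auto simp: diagm_def)
  qed
  then show ?thesis using assms by (simp add: vec_eq_iff mult.commute)
qed

lemma borel_measurable_matrixI:
  fixes F :: "'a \<Rightarrow> complex^'n^'m"
  assumes "\<And>i j. (\<lambda>z. F z $ i $ j) \<in> borel_measurable M"
  shows "F \<in> borel_measurable M"
proof (subst borel_measurable_euclidean_space, intro ballI)
  fix b :: "complex^'n^'m" assume "b \<in> Basis"
  then obtain i j c where "b = axis i (axis j c)" by (auto simp: Basis_vec_def)
  then show "(\<lambda>z. F z \<bullet> b) \<in> borel_measurable M" using assms by (simp add: inner_axis)
qed

lemma borel_measurable_entry [measurable (raw)]:
  fixes F :: "'a \<Rightarrow> complex^'n^'m"
  assumes "F \<in> borel_measurable M"
  shows "(\<lambda>z. F z $ i $ j) \<in> borel_measurable M"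
  by (rule borel_measurable_continuous_on[OF _ assms]) (intro continuous_intros)

lemma cmod_entry_le:
  fixes X :: "complex^'n^'m"
  shows "cmod (X $ i $ j) \<le> norm X"
  by (meson Finite_Cartesian_Product.norm_nth_le order.trans)

definition frame :: "('n \<Rightarrow> complex^'n) \<Rightarrow> complex^'n^'n" where
  "frame u = (\<chi> a i. u i $ a)"

text \<open>Row \<open>i\<close> is the functional sending x to
  \<open>cdot (E i *v x) (u i)\<close>, meant to read off the coefficient at
  \<open>u i\<close>.\<close>

definition coframe :: "('n \<Rightarrow> complex^'n^'n) \<Rightarrow> ('n \<Rightarrow> complex^'n) \<Rightarrow> complex^'n^'n" where
  "coframe E u = (\<chi> i b. cnj ((adjm (E i) *v u i) $ b))"

lemma coframe_mult_frame_entry: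
  "(coframe E u ** G ** frame u) $ i $ j = cdot (E i *v (G *v u j)) (u i)"
proof -
  have "(coframe E u ** G ** frame u) $ i $ j = (coframe E u ** (G ** frame u)) $ i $ j"
    by (simp add: matrix_mul_assoc)
  also have "\<dots> = (\<Sum>b\<in>UNIV. coframe E u $ i $ b * (G *v u j) $ b)"
    by (simp add: matrix_matrix_mult_def matrix_vector_mult_def frame_def)
  also have "\<dots> = cdot (G *v u j) (adjm (E i) *v u i)"
    by (simp add: coframe_def cdot_def mult.commute)
  finally show ?thesis by (simp add: cdot_adjm)
qed

text \<open>If \<open>G\<close> commutes with all \<open>E i\<close>, then \<open>G *v u j\<close>
  stays in the range of \<open>E j\<close>, where every functional of another index vanishes. For
  the identity this gives the duality of the two frames; the inverse on the other side follows
  because the matrices are square.\<close>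

lemma frame_of_orthogonal_idempotents:
  fixes E :: "'n::finite \<Rightarrow> complex^'n^'n"
  assumes orth: "\<And>i j. i \<noteq> j \<Longrightarrow> E i ** E j = 0"
    and u: "\<And>i. norm (u i) = 1" "\<And>i. E i *v u i = u i"
  shows "coframe E u ** frame u = mat 1" "frame u ** coframe E u = mat 1"
    and "(\<And>i. G ** E i = E i ** G) \<Longrightarrow> diagm (coframe E u ** G ** frame u)"
proof -
  have *: "E i *v (G *v u j) = 0" if "i \<noteq> j" "\<And>i. G ** E i = E i ** G" for i j G
  proof -
    have "E i *v (G *v u j) = (E i ** G) *v (E j *v u j)" using u by (simp add: matrix_vector_mul_assoc)
    also have "\<dots> = (G ** (E i ** E j)) *v u j"
      using that(2) by (simp add: matrix_vector_mul_assoc matrix_mul_assoc)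
    finally show ?thesis using orth[OF that(1)] by simp
  qed
  show "diagm (coframe E u ** G ** frame u)" if "\<And>i. G ** E i = E i ** G"
    using *[OF _ that] by (simp add: diagm_def coframe_mult_frame_entry) (simp add: cdot_def)
  have "(coframe E u ** mat 1 ** frame u) $ i $ j = mat 1 $ i $ j" for i j
  proof (cases "i = j")
    case True
    have "cdot (E j *v u j) (u j) = 1" using u by (simp add: cdot_self)
    then show ?thesis using True
      by (simp only: coframe_mult_frame_entry matrix_vector_mul_lid) (simp add: mat_def)
  next
    case False
    have "E i *v u j = 0" using *[of i j "mat 1"] False by simp
    then show ?thesis using False
      by (simp only: coframe_mult_frame_entry matrix_vector_mul_lid) (simp add: mat_def cdot_def)
  qed
  then show "coframe E u ** frame u = mat 1" by (simp add: vec_eq_iff)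
  then show "frame u ** coframe E u = mat 1" by (simp add: matrix_left_right_inverse)
qed

text \<open>The columns of an idempotent lie in its range, so a measurably chosen nonzero column can
  be normalized. When all columns vanish, \<open>inverse 0 = 0\<close> gives the vector 0.\<close>

lemma exists_measurable_unit_range_vector:
  fixes E :: "'a \<Rightarrow> complex^'n^'n"
  assumes [measurable]: "E \<in> borel_measurable M"
  shows "\<exists>u \<in> borel_measurable M. \<forall>z. norm (u z) \<le> 1 \<and>
    (E z \<noteq> 0 \<and> E z ** E z = E z \<longrightarrow> norm (u z) = 1 \<and> E z *v u z = u z)"
proof -
  have [measurable]: "(\<lambda>z. column k (E z)) \<in> borel_measurable M" for k
    unfolding column_def
    by (rule borel_measurable_continuous_on[OF _ assms]) (intro continuous_intros)
  obtain k where k: "k \<in> measurable M (count_space UNIV)"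
    "\<And>z. \<exists>k. column k (E z) \<noteq> 0 \<Longrightarrow> column (k z) (E z) \<noteq> 0"
    using measurable_choice_countable[of "\<lambda>k z. column k (E z) \<noteq> 0" M] by auto
  define w where "w = (\<lambda>z. column (k z) (E z))"
  have [measurable]: "w \<in> borel_measurable M"
    unfolding w_def by (rule measurable_compose_countable[OF _ k(1)]) measurable
  show ?thesis
  proof (intro bexI[of _ "\<lambda>z. inverse (norm (w z)) *\<^sub>R w z"] allI conjI impI)
    fix z
    show "norm (inverse (norm (w z)) *\<^sub>R w z) \<le> 1" by (cases "w z = 0") auto
    assume E: "E z \<noteq> 0 \<and> E z ** E z = E z"
    then have "\<exists>k. column k (E z) \<noteq> 0" by (auto simp: vec_eq_iff column_def)
    then have "w z \<noteq> 0" using k(2) by (simp add: w_def)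
    then show "norm (inverse (norm (w z)) *\<^sub>R w z) = 1" by simp
    have "E z *v column k (E z) = column k (E z ** E z)" for k
      by (simp add: vec_eq_iff column_def matrix_vector_mult_def matrix_matrix_mult_def)
    then show "E z *v (inverse (norm (w z)) *\<^sub>R w z) = inverse (norm (w z)) *\<^sub>R w z"
      using E by (simp add: w_def linear_scale[OF matrix_vector_mul_linear])
  qed measurable
qed

definition ess_bounded :: "'a measure \<Rightarrow> ('a \<Rightarrow> complex^'n^'n) \<Rightarrow> bool" where
  "ess_bounded M G \<longleftrightarrow> G \<in> borel_measurable M \<and> (\<exists>c. AE z in M. norm (G z) \<le> c)"

context max_abelian
begin

text \<open>The frame consists of unit vectors in the ranges of a full resolution. Whatever commutes
  with the resolution becomes diagonal, in particular \<open>A\<close> and \<open>PP\<close>.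
  Conversely, diagonal matrices commute, so an idempotent that is diagonal in the frame commutes
  with \<open>A\<close> and \<open>PP\<close> and enters by maximality.\<close>

lemma exists_diagonalization:
  "\<exists>(U :: 'a \<Rightarrow> complex^'n^'n) (V :: 'a \<Rightarrow> complex^'n^'n).
    ess_bounded M U \<and> ess_bounded M V \<and>
    (AE z in M. V z ** U z = mat 1 \<and> U z ** V z = mat 1) \<and>
    (AE z in M. diagm (V z ** A z ** U z)) \<and>
    (\<forall>G. ess_bounded M G \<longrightarrow>
      (G \<in> PP \<longleftrightarrow> (AE z in M. diagm (V z ** G z ** U z) \<and> G z ** G z = G z)))"
proof -
  obtain E where E: "E \<in> resolutions" "AE z in M. \<forall>j. E j z \<noteq> 0"
    using exists_full_resolution by blast
  have EP: "E i \<in> PP" for i using E by (simp add: resolutions_def)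
  note [measurable] = meas[OF EP]
  have "\<forall>i. \<exists>u. u \<in> borel_measurable M \<and> (\<forall>z. norm (u z) \<le> 1 \<and>
      (E i z \<noteq> 0 \<and> E i z ** E i z = E i z \<longrightarrow> norm (u z) = 1 \<and> E i z *v u z = u z))"
    using exists_measurable_unit_range_vector[OF meas[OF EP]] by blast
  from choice[OF this] obtain u where [measurable]: "\<And>i. u i \<in> borel_measurable M"
    and u_le: "\<And>i z. norm (u i z) \<le> 1"
    and u': "\<And>i z. E i z \<noteq> 0 \<Longrightarrow> E i z ** E i z = E i z \<Longrightarrow> norm (u i z) = 1 \<and> E i z *v u i z = u i z"
    by auto
  define U where "U = (\<lambda>z. frame (\<lambda>i. u i z))"
  define V where "V = (\<lambda>z. coframe (\<lambda>i. E i z) (\<lambda>i. u i z))"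
  have u_entry: "(\<lambda>z. u i z $ a) \<in> borel_measurable M" for i a
    by (rule borel_measurable_continuous_on[of "\<lambda>x. x $ a"]) (intro continuous_intros, simp)
  note [measurable] = u_entry
  have U_meas: "U \<in> borel_measurable M"
    by (rule borel_measurable_matrixI) (simp add: U_def frame_def u_entry)
  have V_meas: "V \<in> borel_measurable M"
  proof (rule borel_measurable_matrixI)
    fix i j
    have [measurable]: "(\<lambda>z. cnj (F z)) \<in> borel_measurable M" if [measurable]: "F \<in> borel_measurable M" for F :: "'a \<Rightarrow> complex"
      by (rule borel_measurable_continuous_on[of cnj]) (intro continuous_intros, simp)
    show "(\<lambda>z. V z $ i $ j) \<in> borel_measurable M"
      by (simp add: V_def coframe_def matrix_vector_mult_def adjm_def)
  qed
  have u1: "cmod (u i z $ a) \<le> 1" for i z a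
    using Finite_Cartesian_Product.norm_nth_le[of "u i z" a] u_le[of i z] by linarith
  have "norm (U z) \<le> real CARD('n) * real CARD('n) * 1" for z
    by (rule norm_matrix_le) (simp add: U_def frame_def u1)
  then have U_bd: "\<exists>c. AE z in M. norm (U z) \<le> c" by blast
  have "AE z in M. \<forall>i. norm (E i z) \<le> C" using bound[OF EP] by (simp add: AE_all_countable)
  \<comment> \<open>Each entry of \<open>V z\<close> is a sum of n products of an entry of
    \<open>E i z\<close>, of modulus at most \<open>C\<close>, and one of a vector of norm at most
    1.\<close>
  then have "AE z in M. norm (V z) \<le> real CARD('n) * real CARD('n) * (real CARD('n) * C)"
  proof eventually_elim
    case (elim z)
    show ?case
    proof (rule norm_matrix_le)
      fix i j
      have "cmod (V z $ i $ j) \<le> (\<Sum>a\<in>UNIV. cmod (E i z $ a $ j) * cmod (u i z $ a))"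
        by (simp add: V_def coframe_def matrix_vector_mult_def adjm_def)
          (rule order.trans[OF norm_sum], simp add: norm_mult)
      also have "\<dots> \<le> (\<Sum>a\<in>(UNIV::'n set). C * 1)"
        using elim by (intro sum_mono mult_mono u1) (auto intro: order.trans[OF cmod_entry_le] order.trans[OF norm_ge_zero])
      finally show "cmod (V z $ i $ j) \<le> real CARD('n) * C" by simp
    qed
  qed
  then have V_bd: "\<exists>c. AE z in M. norm (V z) \<le> c" by blast
  have "AE z in M. \<forall>i. E i z ** E i z = E i z" using idem[OF EP] by (simp add: AE_all_countable)
  moreover have "AE z in M. (\<forall>i j. i \<noteq> j \<longrightarrow> E i z ** E j z = 0) \<and> (\<Sum>i\<in>UNIV. E i z) = mat 1"
    using E by (simp add: resolutions_def)
  \<comment> \<open>The quantifier over \<open>G\<close> is inside the almost-everywhere statement,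
    so the exceptional set does not depend on \<open>G\<close>.\<close>
  ultimately have good: "AE z in M. V z ** U z = mat 1 \<and> U z ** V z = mat 1 \<and>
      (\<forall>G. (\<forall>i. G ** E i z = E i z ** G) \<longrightarrow> diagm (V z ** G ** U z))"
    using E(2)
  proof eventually_elim
    case (elim z)
    note f = frame_of_orthogonal_idempotents[of "\<lambda>i. E i z" "\<lambda>i. u i z"]
    have "norm (u i z) = 1" "E i z *v u i z = u i z" for i using u'[of i z] elim by auto
    then show ?case unfolding U_def V_def using f elim by blast
  qed
  have inv: "AE z in M. V z ** U z = mat 1 \<and> U z ** V z = mat 1"
    using good by eventually_elim simp
  have comm_diag: "AE z in M. diagm (V z ** G z ** U z)"
    if "\<And>i. AE z in M. G z ** E i z = E i z ** G z" for G
  proof -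
    have "AE z in M. \<forall>i. G z ** E i z = E i z ** G z" using that by (simp add: AE_all_countable)
    then show ?thesis using good by eventually_elim simp
  qed
  \<comment> \<open>Conjugation by the frame is multiplicative and invertible, so commutation of the
    diagonal forms can be pulled back.\<close>
  have diag_comm: "AE z in M. G z ** H z = H z ** G z"
    if "AE z in M. diagm (V z ** G z ** U z)" "AE z in M. diagm (V z ** H z ** U z)" for G H
    using inv that
  proof eventually_elim
    case (elim z)
    have *: "(V z ** X ** U z) ** (V z ** Y ** U z) = V z ** (X ** Y) ** U z" for X Y
      using elim(1) by (metis matrix_mul_assoc matrix_mul_rid)
    have "V z ** (G z ** H z) ** U z = V z ** (H z ** G z) ** U z"
      using diagm_commute[OF elim(2,3)] by (simp only: *)
    then have "U z ** (V z ** (G z ** H z) ** U z) ** V z = U z ** (V z ** (H z ** G z) ** U z) ** V z"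
      by simp
    moreover have "U z ** (V z ** X ** U z) ** V z = X" for X
      using elim(1) by (metis matrix_mul_assoc matrix_mul_lid matrix_mul_rid)
    ultimately show ?case by simp
  qed
  have diag_A: "AE z in M. diagm (V z ** A z ** U z)" by (rule comm_diag) (rule comm_A[OF EP])
  have diag_P: "AE z in M. diagm (V z ** G z ** U z)" if "G \<in> PP" for G
    by (rule comm_diag) (rule comm[OF that EP])
  show ?thesis
  proof (rule exI[of _ U], rule exI[of _ V], intro conjI allI impI)
    fix G :: "'a \<Rightarrow> complex^'n^'n"
    assume "ess_bounded M G"
    then have G: "G \<in> borel_measurable M" "\<exists>c. AE z in M. norm (G z) \<le> c"
      by (simp_all add: ess_bounded_def)
    show "G \<in> PP \<longleftrightarrow> (AE z in M. diagm (V z ** G z ** U z) \<and> G z ** G z = G z)"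
    proof
      assume "G \<in> PP"
      then show "AE z in M. diagm (V z ** G z ** U z) \<and> G z ** G z = G z"
        using diag_P idem by auto
    next
      assume *: "AE z in M. diagm (V z ** G z ** U z) \<and> G z ** G z = G z"
      then have dG: "AE z in M. diagm (V z ** G z ** U z)" by eventually_elim simp
      obtain c where "AE z in M. norm (G z) \<le> c" using G(2) by blast
      then show "G \<in> PP"
      proof (rule maximal[OF G(1)])
        show "AE z in M. G z ** G z = G z" using * by eventually_elim simp
        show "AE z in M. A z ** G z = G z ** A z" by (rule diag_comm[OF diag_A dG])
        show "AE z in M. H z ** G z = G z ** H z" if "H \<in> PP" for H
          by (rule diag_comm[OF diag_P[OF that] dG])
      qed
    qed
  qed (use U_meas V_meas U_bd V_bd inv diag_A in \<open>auto simp: ess_bounded_def\<close>)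
qed

end

section \<open>Matrix functions as operators\<close>

lemma rep_ae_class:
  assumes "f \<in> borel_measurable M"
  shows "rep (ae_class M f) \<in> borel_measurable M" "AE z in M. rep (ae_class M f) z = f z"
proof -
  have "rep (ae_class M f) \<in> ae_class M f"
    unfolding rep_def by (rule someI[of _ f]) (use assms in \<open>simp add: ae_class_def\<close>)
  then show "rep (ae_class M f) \<in> borel_measurable M" "AE z in M. rep (ae_class M f) z = f z"
    by (simp_all add: ae_class_def)
qed

lemma ae_class_eq_iff:
  assumes "f \<in> borel_measurable M" "g \<in> borel_measurable M"
  shows "ae_class M f = ae_class M g \<longleftrightarrow> (AE z in M. f z = g z)"
proof
  assume "ae_class M f = ae_class M g"
  then have "f \<in> ae_class M g" using assms by (auto simp: ae_class_def)
  then show "AE z in M. f z = g z" by (simp add: ae_class_def)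
next
  assume fg: "AE z in M. f z = g z"
  have "(AE z in M. h z = f z) \<longleftrightarrow> (AE z in M. h z = g z)" for h
    proof
    assume "AE z in M. h z = f z"
    then show "AE z in M. h z = g z" using fg by eventually_elim simp
  next
    assume "AE z in M. h z = g z"
    then show "AE z in M. h z = f z" using fg by eventually_elim simp
  qed
  then show "ae_class M f = ae_class M g" by (simp add: ae_class_def)
qed

section \<open>Vector-valued representatives and fibrewise action\<close>

definition square_integrable :: "'a measure \<Rightarrow> ('a \<Rightarrow> complex^'n) \<Rightarrow> bool" where
  "square_integrable M f \<longleftrightarrow> f \<in> borel_measurable M \<and> integrable M (\<lambda>z. (norm (f z))\<^sup>2)"

definition vrep :: "('a \<Rightarrow> complex) set ^ 'n \<Rightarrow> 'a \<Rightarrow> complex^'n" where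
  "vrep x z = (\<chi> i. rep (x $ i) z)"

definition vclass :: "'a measure \<Rightarrow> ('a \<Rightarrow> complex^'n) \<Rightarrow> ('a \<Rightarrow> complex) set ^ 'n" where
  "vclass M f = (\<chi> i. ae_class M (\<lambda>z. f z $ i))"

text \<open>Takes a matrix-valued function in place of a matrix of functions, the form in which the
  fibrewise arguments take place.\<close>

definition mop :: "'a measure \<Rightarrow> ('a \<Rightarrow> complex^'n^'n) \<Rightarrow> ('a, 'n::finite) nL2_op" where
  "mop M G = matrix_op M (\<chi> i j. (\<lambda>z. G z $ i $ j))"

lemma norm_vec_power2: "(norm x)\<^sup>2 = (\<Sum>i\<in>UNIV. (cmod (x $ i))\<^sup>2)" for x :: "complex^'n"
  by (simp add: norm_vec_def L2_set_def sum_nonneg)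

lemma borel_measurable_vecI:
  fixes f :: "'a \<Rightarrow> complex^'n"
  assumes "\<And>i. (\<lambda>z. f z $ i) \<in> borel_measurable M"
  shows "f \<in> borel_measurable M"
proof (subst borel_measurable_euclidean_space, intro ballI)
  fix b :: "complex^'n" assume "b \<in> Basis"
  then obtain i c where "b = axis i c" by (auto simp: Basis_vec_def)
  then show "(\<lambda>z. f z \<bullet> b) \<in> borel_measurable M" using assms by (simp add: inner_axis)
qed

lemma borel_measurable_vec_component [measurable (raw)]:
  fixes f :: "'a \<Rightarrow> complex^'n"
  assumes "f \<in> borel_measurable M"
  shows "(\<lambda>z. f z $ i) \<in> borel_measurable M"
  by (rule borel_measurable_continuous_on[OF _ assms]) (intro continuous_intros)

lemma borel_measurable_adjm [measurable (raw)]: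
  assumes "G \<in> borel_measurable M"
  shows "(\<lambda>z. adjm (G z)) \<in> borel_measurable M"
  unfolding adjm_def by (rule borel_measurable_continuous_on[OF _ assms]) (intro continuous_intros)

lemma square_integrable_dominated:
  assumes "square_integrable M f" "g \<in> borel_measurable M" "AE z in M. norm (g z) \<le> c * norm (f z)"
  shows "square_integrable M g"
  unfolding square_integrable_def
proof
  have "integrable M (\<lambda>z. c\<^sup>2 * (norm (f z))\<^sup>2)" using assms(1) by (simp add: square_integrable_def)
  then show "integrable M (\<lambda>z. (norm (g z))\<^sup>2)"
  proof (rule Bochner_Integration.integrable_bound)
    show "AE z in M. norm ((norm (g z))\<^sup>2) \<le> norm (c\<^sup>2 * (norm (f z))\<^sup>2)"
      using assms(3)
    proof eventually_elim
      case (elim z)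
      then have "(norm (g z))\<^sup>2 \<le> (c * norm (f z))\<^sup>2" by (intro power_mono) auto
      then show ?case by (simp add: power_mult_distrib)
    qed
  qed (use assms(2) in measurable)
qed (fact assms(2))

lemma square_integrable_diff:
  assumes "square_integrable M f" "square_integrable M g"
  shows "square_integrable M (\<lambda>z. f z - g z)"
proof -
  have [measurable]: "f \<in> borel_measurable M" "g \<in> borel_measurable M"
    using assms by (auto simp: square_integrable_def)
  have "integrable M (\<lambda>z. 2 * (norm (f z))\<^sup>2 + 2 * (norm (g z))\<^sup>2)"
    using assms by (auto simp: square_integrable_def)
  then have "integrable M (\<lambda>z. (norm (f z - g z))\<^sup>2)"
  proof (rule Bochner_Integration.integrable_bound)
    show "AE z in M. norm ((norm (f z - g z))\<^sup>2) \<le> norm (2 * (norm (f z))\<^sup>2 + 2 * (norm (g z))\<^sup>2)"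
    proof (rule AE_I2)
      fix z
      have "(norm (f z - g z))\<^sup>2 \<le> (norm (f z) + norm (g z))\<^sup>2"
        by (intro power_mono norm_triangle_ineq4) auto
      also have "\<dots> \<le> 2 * (norm (f z))\<^sup>2 + 2 * (norm (g z))\<^sup>2"
        using sum_squares_bound[of "norm (f z)" "norm (g z)"] by (simp add: power2_sum)
      finally show "norm ((norm (f z - g z))\<^sup>2) \<le> norm (2 * (norm (f z))\<^sup>2 + 2 * (norm (g z))\<^sup>2)" by simp
    qed
  qed measurable
  then show ?thesis by (simp add: square_integrable_def)
qed

lemma cmod_cdot_le: "cmod (cdot x y) \<le> (norm x)\<^sup>2 + (norm y)\<^sup>2"
proof -
  have "cmod (cdot x y) \<le> (\<Sum>i\<in>UNIV. cmod (x $ i) * cmod (y $ i))"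
    unfolding cdot_def by (rule order.trans[OF norm_sum]) (simp add: norm_mult)
  also have "\<dots> \<le> (\<Sum>i\<in>UNIV. (cmod (x $ i))\<^sup>2 + (cmod (y $ i))\<^sup>2)"
  proof (rule sum_mono)
    fix i
    have "2 * cmod (x $ i) * cmod (y $ i) \<le> (cmod (x $ i))\<^sup>2 + (cmod (y $ i))\<^sup>2" by (rule sum_squares_bound)
    moreover have "0 \<le> cmod (x $ i) * cmod (y $ i)" by simp
    ultimately show "cmod (x $ i) * cmod (y $ i) \<le> (cmod (x $ i))\<^sup>2 + (cmod (y $ i))\<^sup>2" by linarith
  qed
  finally show ?thesis by (simp add: norm_vec_power2 sum.distrib)
qed

lemma borel_measurable_cdot [measurable (raw)]:
  assumes "f \<in> borel_measurable M" "g \<in> borel_measurable M"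
  shows "(\<lambda>z. cdot (f z) (g z)) \<in> borel_measurable M"
  by (rule borel_measurable_continuous_Pair[OF assms]) (intro continuous_intros)

lemma integrable_cdot:
  assumes "square_integrable M f" "square_integrable M g"
  shows "integrable M (\<lambda>z. cdot (f z) (g z))"
proof (rule Bochner_Integration.integrable_bound)
  show "integrable M (\<lambda>z. (norm (f z))\<^sup>2 + (norm (g z))\<^sup>2)"
    using assms by (auto simp: square_integrable_def)
  show "(\<lambda>z. cdot (f z) (g z)) \<in> borel_measurable M"
    using assms by (intro borel_measurable_cdot) (auto simp: square_integrable_def)
qed (use cmod_cdot_le in auto)

text \<open>The representative chosen by \<open>rep\<close> agrees almost everywhere with a
  square-integrable one, and so inherits integrability and gives back the same class.\<close>

lemma vrep_nL2:
  assumes "x \<in> nL2 M"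
  shows "square_integrable M (vrep x)" "vclass M (vrep x) = x"
proof -
  have *: "rep (x $ i) \<in> borel_measurable M \<and> integrable M (\<lambda>z. (cmod (rep (x $ i) z))\<^sup>2) \<and>
      ae_class M (rep (x $ i)) = x $ i" for i
  proof -
    obtain f where f: "x $ i = ae_class M f" "f \<in> borel_measurable M" "integrable M (\<lambda>z. (cmod (f z))\<^sup>2)"
      using assms by (auto simp: nL2_def L2_def)
    note r = rep_ae_class[OF f(2), folded f(1)]
    have "integrable M (\<lambda>z. (cmod (rep (x $ i) z))\<^sup>2)"
      using f(2) r by (intro integrable_cong_AE_imp[OF f(3)]) (auto elim!: eventually_mono)
    moreover have "ae_class M (rep (x $ i)) = x $ i"
      using r f(1,2) ae_class_eq_iff[OF r(1) f(2)] by simp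
    ultimately show ?thesis using r(1) by simp
  qed
  have "vrep x \<in> borel_measurable M"
    by (rule borel_measurable_vecI) (use * in \<open>simp add: vrep_def\<close>)
  moreover have "integrable M (\<lambda>z. (norm (vrep x z))\<^sup>2)"
    unfolding norm_vec_power2 using * by (simp add: vrep_def)
  ultimately show "square_integrable M (vrep x)" by (simp add: square_integrable_def)
  show "vclass M (vrep x) = x" using * by (simp add: vclass_def vrep_def vec_eq_iff)
qed

lemma square_integrable_nth:
  assumes "square_integrable M f"
  shows "integrable M (\<lambda>z. (cmod (f z $ i))\<^sup>2)"
proof (rule Bochner_Integration.integrable_bound)
  show "integrable M (\<lambda>z. (norm (f z))\<^sup>2)" using assms by (simp add: square_integrable_def)
  show "AE z in M. norm ((cmod (f z $ i))\<^sup>2) \<le> norm ((norm (f z))\<^sup>2)"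
    by (auto intro!: AE_I2 power_mono Finite_Cartesian_Product.norm_nth_le)
  have [measurable]: "f \<in> borel_measurable M" using assms by (simp add: square_integrable_def)
  show "(\<lambda>z. (cmod (f z $ i))\<^sup>2) \<in> borel_measurable M" by measurable
qed

lemma vclass_in_nL2:
  assumes "square_integrable M f"
  shows "vclass M f \<in> nL2 M"
  using square_integrable_nth[OF assms] assms
  by (auto simp: nL2_def L2_def vclass_def square_integrable_def)

lemma vrep_vclass:
  assumes "f \<in> borel_measurable M"
  shows "AE z in M. vrep (vclass M f) z = f z"
proof -
  have "AE z in M. rep (ae_class M (\<lambda>z. f z $ i)) z = f z $ i" for i
    using assms by (intro rep_ae_class) measurable
  then have "AE z in M. \<forall>i. rep (ae_class M (\<lambda>z. f z $ i)) z = f z $ i"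
    unfolding AE_all_countable by blast
  then show ?thesis by eventually_elim (simp add: vrep_def vclass_def vec_eq_iff)
qed

lemma vclass_eq_iff:
  assumes "f \<in> borel_measurable M" "g \<in> borel_measurable M"
  shows "vclass M f = vclass M g \<longleftrightarrow> (AE z in M. f z = g z)"
proof -
  have "vclass M f = vclass M g \<longleftrightarrow> (\<forall>i. AE z in M. f z $ i = g z $ i)"
    unfolding vclass_def vec_eq_iff using assms by (simp add: ae_class_eq_iff)
  also have "\<dots> \<longleftrightarrow> (AE z in M. f z = g z)" by (simp add: vec_eq_iff AE_all_countable)
  finally show ?thesis .
qed

lemma mop_apply: "x \<in> nL2 M \<Longrightarrow> mop M G x = vclass M (\<lambda>z. G z *v vrep x z)"
  by (simp add: mop_def matrix_op_def vclass_def vrep_def matrix_vector_mult_def)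

lemma mop_extensional: "mop M G \<in> extensional (nL2 M)"
  by (simp add: mop_def matrix_op_def)

lemma ess_bounded_mult:
  assumes "ess_bounded M F" "ess_bounded M G"
  shows "ess_bounded M (\<lambda>z. F z ** G z)"
  using assms AE_bounded_matrix_mult[of F M G] by (auto simp: ess_bounded_def)

lemma ess_bounded_const: "ess_bounded M (\<lambda>z. X)"
  by (auto simp: ess_bounded_def)

lemma ess_bounded_adjm:
  assumes "ess_bounded M G"
  shows "ess_bounded M (\<lambda>z. adjm (G z))"
proof -
  obtain c where "AE z in M. norm (G z) \<le> c" and [measurable]: "G \<in> borel_measurable M"
    using assms by (auto simp: ess_bounded_def)
  then have "AE z in M. norm (adjm (G z)) \<le> real CARD('b) * real CARD('b) * c"
    by (elim eventually_mono, intro norm_matrix_le) (auto simp: adjm_def intro: order.trans[OF cmod_entry_le])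
  then show ?thesis by (auto simp: ess_bounded_def)
qed

text \<open>The bound holds for all \<open>v\<close> off a single null set, so it may be applied to
  a vector that varies with \<open>z\<close>.\<close>

lemma ess_bounded_vector_bound:
  fixes G :: "'a \<Rightarrow> complex^'n^'n"
  assumes "ess_bounded M G"
  shows "\<exists>c\<ge>0. AE z in M. \<forall>v. norm (G z *v v) \<le> c * norm v"
proof -
  obtain K where K: "K > 0" "\<forall>(X :: complex^'n^'n) (v :: complex^'n). norm (X *v v) \<le> norm X * norm v * K"
    using bounded_bilinear.pos_bounded[OF bounded_bilinear_matrix_vector_mult[where 'n='n]] by (elim exE conjE)
  obtain c where "AE z in M. norm (G z) \<le> c" using assms by (auto simp: ess_bounded_def)
  \<comment> \<open>Over a space of measure zero \<open>c\<close> may be negative, hence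
    \<open>max c 0\<close>.\<close>
  then have "AE z in M. \<forall>v. norm (G z *v v) \<le> (max c 0 * K) * norm v"
  proof eventually_elim
    case (elim z)
    have "norm (G z) * norm v * K \<le> max c 0 * norm v * K" for v :: "complex^'n"
      using elim K(1) by (intro mult_right_mono) auto
    then show ?case using K(2) by (metis (no_types, lifting) order.trans mult.assoc mult.commute)
  qed
  then show ?thesis using K(1) by (intro exI[of _ "max c 0 * K"]) auto
qed

lemma square_integrable_matrix_mult:
  assumes "ess_bounded M G" "square_integrable M f"
  shows "square_integrable M (\<lambda>z. G z *v f z)"
proof -
  have [measurable]: "G \<in> borel_measurable M" "f \<in> borel_measurable M"
    using assms by (auto simp: ess_bounded_def square_integrable_def)
  obtain c where "AE z in M. \<forall>v. norm (G z *v v) \<le> c * norm v"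
    using ess_bounded_vector_bound[OF assms(1)] by blast
  then have "AE z in M. norm (G z *v f z) \<le> c * norm (f z)" by eventually_elim simp
  then show ?thesis by (intro square_integrable_dominated[OF assms(2)]) measurable
qed

lemma mop_in_nL2: "ess_bounded M G \<Longrightarrow> x \<in> nL2 M \<Longrightarrow> mop M G x \<in> nL2 M"
  by (simp add: mop_apply vclass_in_nL2 square_integrable_matrix_mult vrep_nL2)

lemma mop_vclass:
  assumes "ess_bounded M G" "square_integrable M f"
  shows "mop M G (vclass M f) = vclass M (\<lambda>z. G z *v f z)"
proof -
  have [measurable]: "G \<in> borel_measurable M" "f \<in> borel_measurable M"
    using assms by (auto simp: ess_bounded_def square_integrable_def)
  have [measurable]: "vrep (vclass M f) \<in> borel_measurable M"
    using vrep_nL2(1)[OF vclass_in_nL2[OF assms(2)]] by (simp add: square_integrable_def)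
  have "AE z in M. G z *v vrep (vclass M f) z = G z *v f z"
    using vrep_vclass[of f M] by (auto elim!: eventually_mono)
  then show ?thesis
    by (subst mop_apply[OF vclass_in_nL2[OF assms(2)]], subst vclass_eq_iff) measurable
qed

lemma op_mult_mop:
  fixes F G :: "'a \<Rightarrow> complex^'n^'n"
  assumes "ess_bounded M F" "ess_bounded M G"
  shows "op_mult M (mop M F) (mop M G) = mop M (\<lambda>z. F z ** G z)"
  unfolding op_mult_def
proof (rule extensionalityI[OF compose_extensional mop_extensional])
  fix x :: "('a \<Rightarrow> complex) set^'n"
  assume x: "x \<in> nL2 M"
  have "mop M F (vclass M (\<lambda>z. G z *v vrep x z)) = vclass M (\<lambda>z. F z *v (G z *v vrep x z))"
    by (rule mop_vclass[OF assms(1) square_integrable_matrix_mult[OF assms(2) vrep_nL2(1)[OF x]]])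
  then show "compose (nL2 M) (mop M F) (mop M G) x = mop M (\<lambda>z. F z ** G z) x"
    using x by (simp add: compose_eq mop_apply matrix_vector_mul_assoc)
qed

lemma op_one_mop: "op_one M = mop M (\<lambda>z. mat 1)"
  unfolding op_one_def
  by (rule extensionalityI[OF restrict_extensional mop_extensional])
    (simp add: mop_apply vrep_nL2)

lemma mop_cong_AE:
  fixes F G :: "'a \<Rightarrow> complex^'n^'n"
  assumes [measurable]: "F \<in> borel_measurable M" "G \<in> borel_measurable M" and FG: "AE z in M. F z = G z"
  shows "mop M F = mop M G"
proof (rule extensionalityI[OF mop_extensional mop_extensional])
  fix x :: "('a \<Rightarrow> complex) set^'n"
  assume x: "x \<in> nL2 M"
  then have [measurable]: "vrep x \<in> borel_measurable M"
    using vrep_nL2(1) by (auto simp: square_integrable_def)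
  have "AE z in M. F z *v vrep x z = G z *v vrep x z" using FG by eventually_elim simp
  then show "mop M F x = mop M G x"
    using x by (simp add: mop_apply vclass_eq_iff)
qed

text \<open>The entries have finitely many separate bounds, whose maximum controls the matrix norm;
  conversely each entry is dominated by the norm.\<close>

lemma Mn_Linf_eq: "(Mn_Linf M :: ('a, 'n::finite) nL2_op set) = mop M ` Collect (ess_bounded M)"
proof (intro equalityI subsetI)
  fix T :: "('a, 'n) nL2_op"
  assume "T \<in> (Mn_Linf M :: ('a, 'n) nL2_op set)"
  then obtain F where F: "T = matrix_op M F" "\<And>i j. F $ i $ j \<in> Linf M" by (auto simp: Mn_Linf_def)
  define G where "G = (\<lambda>z. \<chi> i j. (F $ i $ j) z)"
  have "G \<in> borel_measurable M"
    by (rule borel_measurable_matrixI) (use F(2) in \<open>auto simp: G_def Linf_def\<close>)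
  moreover have "\<exists>c. AE z in M. norm (G z) \<le> c"
  proof -
    have "\<forall>i j. \<exists>c. AE z in M. cmod ((F $ i $ j) z) \<le> c" using F(2) by (auto simp: Linf_def)
    then obtain c where c: "\<And>i j. AE z in M. cmod ((F $ i $ j) z) \<le> c i j" by metis
    have "AE z in M. \<forall>i j. cmod ((F $ i $ j) z) \<le> c i j"
      unfolding AE_all_countable using c by blast
    then have "AE z in M. norm (G z) \<le> real CARD('n) * real CARD('n) * (MAX p. c (fst p) (snd p))"
    proof eventually_elim
      case (elim z)
      show ?case
      proof (rule norm_matrix_le)
        fix i j
        have "c i j \<le> (MAX p. c (fst p) (snd p))"
          by (rule Max_ge) (auto intro!: image_eqI[of _ _ "(i, j)"])
        then show "cmod (G z $ i $ j) \<le> (MAX p. c (fst p) (snd p))"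
          using elim by (simp add: G_def) (meson order.trans)
      qed
    qed
    then show ?thesis by blast
  qed
  moreover have "T = mop M G" unfolding mop_def F(1) by (rule arg_cong[of _ _ "matrix_op M"]) (simp add: G_def vec_eq_iff)
  ultimately show "T \<in> mop M ` Collect (ess_bounded M)" by (auto simp: ess_bounded_def)
next
  fix T :: "('a, 'n) nL2_op"
  assume "T \<in> mop M ` Collect (ess_bounded M)"
  then obtain G :: "'a \<Rightarrow> complex^'n^'n" and c where G: "T = mop M G" "G \<in> borel_measurable M" "AE z in M. norm (G z) \<le> c"
    by (auto simp: ess_bounded_def)
  have "AE z in M. cmod (G z $ i $ j) \<le> c" for i j
    using G(3) by eventually_elim (rule order.trans[OF cmod_entry_le])
  then have "(\<lambda>z. G z $ i $ j) \<in> Linf M" for i j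
    using G(2) by (auto simp: Linf_def)
  then show "T \<in> Mn_Linf M" unfolding Mn_Linf_def G(1) mop_def by auto
qed

lemma matrix_mult_axis: "(A *v axis j c) $ i = A $ i $ j * c" for A :: "complex^'n^'n"
  by (simp add: matrix_vector_mult_def axis_def if_distrib[of "\<lambda>a. b * a" for b] cong: if_cong)

section \<open>Norm and inner product in terms of representatives\<close>

lemma nL2_norm_eq:
  assumes "x \<in> nL2 M"
  shows "nL2_norm M x = sqrt (\<integral>z. (norm (vrep x z))\<^sup>2 \<partial>M)"
  unfolding nL2_norm_def norm_vec_power2
  using square_integrable_nth[OF vrep_nL2(1)[OF assms]]
  by (subst Bochner_Integration.integral_sum) (simp_all add: vrep_def)

lemma nL2_inner_eq:
  assumes x: "x \<in> nL2 M" and y: "y \<in> nL2 M"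
  shows "nL2_inner M x y = (\<integral>z. cdot (vrep x z) (vrep y z) \<partial>M)"
proof -
  have [measurable]: "vrep x \<in> borel_measurable M" "vrep y \<in> borel_measurable M"
    using assms vrep_nL2(1) by (auto simp: square_integrable_def)
  have int: "integrable M (\<lambda>z. vrep x z $ i * cnj (vrep y z $ i))" for i
  proof (rule Bochner_Integration.integrable_bound)
    show "integrable M (\<lambda>z. (cmod (vrep x z $ i))\<^sup>2 + (cmod (vrep y z $ i))\<^sup>2)"
      using assms by (intro Bochner_Integration.integrable_add square_integrable_nth vrep_nL2)
    show "AE z in M. norm (vrep x z $ i * cnj (vrep y z $ i)) \<le>
        norm ((cmod (vrep x z $ i))\<^sup>2 + (cmod (vrep y z $ i))\<^sup>2)"
    proof (rule AE_I2)
      fix z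
      have "2 * cmod (vrep x z $ i) * cmod (vrep y z $ i) \<le> (cmod (vrep x z $ i))\<^sup>2 + (cmod (vrep y z $ i))\<^sup>2"
        by (rule sum_squares_bound)
      moreover have "0 \<le> cmod (vrep x z $ i) * cmod (vrep y z $ i)" by simp
      ultimately have "cmod (vrep x z $ i) * cmod (vrep y z $ i) \<le> (cmod (vrep x z $ i))\<^sup>2 + (cmod (vrep y z $ i))\<^sup>2"
        by linarith
      then show "norm (vrep x z $ i * cnj (vrep y z $ i)) \<le>
        norm ((cmod (vrep x z $ i))\<^sup>2 + (cmod (vrep y z $ i))\<^sup>2)" by (simp add: norm_mult)
    qed
    show "(\<lambda>z. vrep x z $ i * cnj (vrep y z $ i)) \<in> borel_measurable M"
      by (rule borel_measurable_continuous_Pair[of "vrep x" M "vrep y" "\<lambda>a b. a $ i * cnj (b $ i)"])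
        (measurable, intro continuous_intros)
  qed
  show ?thesis unfolding nL2_inner_def cdot_def
    using int by (subst Bochner_Integration.integral_sum) (simp_all add: vrep_def)
qed

lemma nL2_norm_vclass:
  assumes "square_integrable M f"
  shows "nL2_norm M (vclass M f) = sqrt (\<integral>z. (norm (f z))\<^sup>2 \<partial>M)"
proof -
  have "(\<integral>z. (norm (vrep (vclass M f) z))\<^sup>2 \<partial>M) = (\<integral>z. (norm (f z))\<^sup>2 \<partial>M)"
    using vrep_vclass[of f M] assms vrep_nL2(1)[OF vclass_in_nL2[OF assms]]
    by (intro integral_cong_AE) (auto simp: square_integrable_def elim!: eventually_mono)
  then show ?thesis by (simp add: nL2_norm_eq[OF vclass_in_nL2[OF assms]])
qed

section \<open>Recovering a matrix function, its bounds and its adjoint from the operator\<close>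

context finite_measure
begin

lemma square_integrable_const: "square_integrable M (\<lambda>z. v)"
  by (simp add: square_integrable_def)

text \<open>Finite measure makes constant vectors square integrable, and applying the operators to
  the constant \<open>axis j 1\<close> recovers column \<open>j\<close>.\<close>

lemma mop_eq_iff:
  fixes F G :: "'a \<Rightarrow> complex^'n^'n"
  assumes F: "ess_bounded M F" and G: "ess_bounded M G"
  shows "mop M F = mop M G \<longleftrightarrow> (AE z in M. F z = G z)"
proof
  assume eq: "mop M F = mop M G"
  have [measurable]: "F \<in> borel_measurable M" "G \<in> borel_measurable M"
    using assms by (auto simp: ess_bounded_def)
  have "AE z in M. F z *v axis j 1 = G z *v axis j 1" for j
  proof -
    have "vclass M (\<lambda>z. F z *v axis j 1) = vclass M (\<lambda>z. G z *v axis j 1)"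
      using mop_vclass[OF F square_integrable_const] mop_vclass[OF G square_integrable_const] eq by metis
    then show ?thesis by (subst (asm) vclass_eq_iff) measurable
  qed
  then have "AE z in M. \<forall>j. F z *v axis j 1 = G z *v axis j 1"
    unfolding AE_all_countable by blast
  then show "AE z in M. F z = G z"
  proof eventually_elim
    case (elim z)
    have "F z $ i $ j = G z $ i $ j" for i j
      using matrix_mult_axis[of "F z" j 1 i] matrix_mult_axis[of "G z" j 1 i] elim by simp
    then show ?case by (simp add: vec_eq_iff)
  qed
qed (use assms in \<open>auto simp: ess_bounded_def intro: mop_cong_AE\<close>)

text \<open>A real supremum dominates its members once the set is bounded above; the fibrewise bound
  \<open>c\<close> provides this.\<close>

lemma nL2_norm_mop_le_op_norm:
  fixes G :: "'a \<Rightarrow> complex^'n^'n"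
  assumes G: "ess_bounded M G" and x: "x \<in> nL2 M" "nL2_norm M x \<le> 1"
  shows "nL2_norm M (mop M G x) \<le> op_norm M (mop M G)"
  unfolding op_norm_def
proof (rule cSUP_upper)
  show "x \<in> {x \<in> nL2 M. nL2_norm M x \<le> 1}" using x by simp
  obtain c where c: "c \<ge> 0" "AE z in M. \<forall>v. norm (G z *v v) \<le> c * norm v"
    using ess_bounded_vector_bound[OF G] by blast
  have "nL2_norm M (mop M G y) \<le> c" if y: "y \<in> nL2 M" "nL2_norm M y \<le> 1" for y
  proof -
    note yi = vrep_nL2(1)[OF y(1)]
    note Gyi = square_integrable_matrix_mult[OF G yi]
    have "(\<integral>z. (norm (G z *v vrep y z))\<^sup>2 \<partial>M) \<le> (\<integral>z. c\<^sup>2 * (norm (vrep y z))\<^sup>2 \<partial>M)"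
    proof (rule integral_mono_AE)
      show "AE z in M. (norm (G z *v vrep y z))\<^sup>2 \<le> c\<^sup>2 * (norm (vrep y z))\<^sup>2"
        using c(2)
      proof eventually_elim
        case (elim z)
        then have "(norm (G z *v vrep y z))\<^sup>2 \<le> (c * norm (vrep y z))\<^sup>2" by (intro power_mono) auto
        then show ?case by (simp add: power_mult_distrib)
      qed
    qed (use yi Gyi in \<open>auto simp: square_integrable_def\<close>)
    also have "\<dots> \<le> c\<^sup>2 * 1"
      using y(2) by (simp add: nL2_norm_eq[OF y(1)] mult_left_le)
    finally have "sqrt (\<integral>z. (norm (G z *v vrep y z))\<^sup>2 \<partial>M) \<le> sqrt (c\<^sup>2)"
      by (intro real_sqrt_le_mono) simp
    then show ?thesis
      using c(1) by (simp add: mop_apply[OF y(1)] nL2_norm_vclass[OF Gyi])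
  qed
  then show "bdd_above ((\<lambda>x. nL2_norm M (mop M G x)) ` {x \<in> nL2 M. nL2_norm M x \<le> 1})"
    by (auto intro!: bdd_aboveI2)
qed

text \<open>If the entry exceeded \<open>C\<close> on a set \<open>S\<close> of positive measure,
  the normalized indicator of \<open>S\<close> in coordinate \<open>j\<close> would be a unit vector
  whose image has norm above \<open>C\<close>.\<close>

lemma entry_le_op_norm:
  fixes G :: "'a \<Rightarrow> complex^'n^'n"
  assumes G: "ess_bounded M G" and C: "op_norm M (mop M G) \<le> C"
  shows "AE z in M. cmod (G z $ i $ j) \<le> C"
proof -
  have [measurable]: "G \<in> borel_measurable M" using G by (simp add: ess_bounded_def)
  define S where "S = {z \<in> space M. C < cmod (G z $ i $ j)}"
  have S [measurable]: "S \<in> sets M" unfolding S_def by measurable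
  show ?thesis
  proof (cases "measure M S = 0")
    case True
    then have "S \<in> null_sets M" using S by (simp add: null_sets_def emeasure_eq_measure)
    then have "AE z in M. z \<notin> S" by (rule AE_not_in)
    then show ?thesis using AE_space by eventually_elim (simp add: S_def not_less)
  next
    case False
    then have mS: "measure M S > 0" by (simp add: measure_nonneg less_le)
    \<comment> \<open>This scaling gives the class of \<open>f\<close> norm 1.\<close>
    define r where "r = 1 / sqrt (measure M S)"
    define f where "f = (\<lambda>z. indicator S z *\<^sub>R (axis j (of_real r) :: complex^'n))"
    have nf: "(norm (f z))\<^sup>2 = r\<^sup>2 * indicator S z" for z
      by (cases "z \<in> S")
        (simp_all add: f_def norm_vec_power2 axis_def if_distrib[of cmod] if_distrib[of "\<lambda>x. x\<^sup>2"] cong: if_cong)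
    have r2: "r\<^sup>2 * measure M S = 1" using mS by (simp add: r_def power_divide)
    have f_meas: "f \<in> borel_measurable M" unfolding f_def by measurable
    have f: "square_integrable M f"
      unfolding square_integrable_def nf using f_meas S
      by (auto simp: emeasure_eq_measure)
    have "nL2_norm M (vclass M f) = 1"
      unfolding nL2_norm_vclass[OF f] nf using r2 S by (simp add: emeasure_eq_measure)
    then have le: "sqrt (\<integral>z. (norm (G z *v f z))\<^sup>2 \<partial>M) \<le> C"
      using nL2_norm_mop_le_op_norm[OF G vclass_in_nL2[OF f]] C
        nL2_norm_vclass[OF square_integrable_matrix_mult[OF G f]] mop_vclass[OF G f] by simp
    have C0: "0 \<le> C" by (rule order.trans[OF _ le]) simp
    have Gf: "integrable M (\<lambda>z. (norm (G z *v f z))\<^sup>2)"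
      using square_integrable_matrix_mult[OF G f] by (simp add: square_integrable_def)
    have intS: "integrable M (\<lambda>z. C\<^sup>2 * (r\<^sup>2 * indicator S z))"
      using f unfolding square_integrable_def nf by auto
    have pt: "C\<^sup>2 * (r\<^sup>2 * indicator S z) \<le> (norm (G z *v f z))\<^sup>2 \<and>
        (z \<in> S \<longrightarrow> C\<^sup>2 * (r\<^sup>2 * indicator S z) < (norm (G z *v f z))\<^sup>2)" for z
    proof (cases "z \<in> S")
      case True
      have "(G z *v f z) $ i = G z $ i $ j * of_real r"
        using True by (simp add: f_def matrix_mult_axis)
      then have "cmod (G z $ i $ j) * r \<le> norm (G z *v f z)"
        using Finite_Cartesian_Product.norm_nth_le[of "G z *v f z" i] mS
        by (simp add: norm_mult norm_divide r_def)
      moreover have "C * r < cmod (G z $ i $ j) * r"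
        using True mS by (intro mult_strict_right_mono) (auto simp: S_def r_def)
      ultimately have "C * r < norm (G z *v f z)" by linarith
      moreover have "0 \<le> C * r" using C0 mS by (simp add: r_def)
      ultimately have "(C * r)\<^sup>2 < (norm (G z *v f z))\<^sup>2" by (intro power_strict_mono) auto
      then show ?thesis using True by (simp add: power_mult_distrib)
    qed simp
    have "(\<integral>z. (norm (G z *v f z))\<^sup>2 \<partial>M) \<le> C\<^sup>2"
      using le C0 by (metis real_sqrt_le_iff real_sqrt_unique sqrt_le_D)
    also have "C\<^sup>2 = (\<integral>z. C\<^sup>2 * (r\<^sup>2 * indicator S z) \<partial>M)"
      using r2 S by (simp add: emeasure_eq_measure)
    \<comment> \<open>The integrand is nonnegative everywhere and positive on \<open>S\<close>, so a
      nonpositive integral makes \<open>S\<close> null.\<close>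
    finally have "(\<integral>z. (norm (G z *v f z))\<^sup>2 - C\<^sup>2 * (r\<^sup>2 * indicator S z) \<partial>M) \<le> 0"
      using Gf intS by simp
    moreover have "0 \<le> (\<integral>z. (norm (G z *v f z))\<^sup>2 - C\<^sup>2 * (r\<^sup>2 * indicator S z) \<partial>M)"
      using pt by (intro integral_nonneg_AE AE_I2) simp
    ultimately have "AE z in M. (norm (G z *v f z))\<^sup>2 - C\<^sup>2 * (r\<^sup>2 * indicator S z) = 0"
      using Gf intS pt by (subst integral_nonneg_eq_0_iff_AE[symmetric]) auto
    then have "AE z in M. z \<notin> S"
    proof eventually_elim
      case (elim z)
      then show ?case using pt[of z] by auto
    qed
    then show ?thesis using AE_space by eventually_elim (simp add: S_def not_less)
  qed
qed

text \<open>\<open>S\<close> is not known in advance to come from a matrix function. Pairing the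
  adjoint identity with the difference \<open>w\<close> of the two candidate images of
  \<open>y\<close> shows that \<open>w\<close> has norm 0.\<close>

lemma adjoint_mop:
  fixes G :: "'a \<Rightarrow> complex^'n^'n"
  assumes G: "ess_bounded M G" and S: "is_adjoint M (mop M G) S"
  shows "S = mop M (\<lambda>z. adjm (G z))"
proof (rule extensionalityI[OF _ mop_extensional])
  show "S \<in> extensional (nL2 M)" using S by (auto simp: is_adjoint_def PiE_def)
  fix y :: "('a \<Rightarrow> complex) set^'n"
  assume y: "y \<in> nL2 M"
  then have Sy: "S y \<in> nL2 M" using S by (auto simp: is_adjoint_def PiE_def)
  note Gs = ess_bounded_adjm[OF G]
  note yi = vrep_nL2(1)[OF y] and Syi = vrep_nL2(1)[OF Sy]
  note Gsy = square_integrable_matrix_mult[OF Gs yi]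
  define w where "w = (\<lambda>z. vrep (S y) z - adjm (G z) *v vrep y z)"
  have w: "square_integrable M w"
    unfolding w_def by (rule square_integrable_diff[OF Syi Gsy])
  have [measurable]: "w \<in> borel_measurable M" "G \<in> borel_measurable M"
      "vrep y \<in> borel_measurable M" "vrep (S y) \<in> borel_measurable M"
    using w yi Syi G by (auto simp: square_integrable_def ess_bounded_def)
  let ?x = "vclass M w"
  note x = vclass_in_nL2[OF w]
  note xi = vrep_nL2(1)[OF x]
  have [measurable]: "vrep ?x \<in> borel_measurable M" using xi by (simp add: square_integrable_def)
  have "vrep (mop M G ?x) \<in> borel_measurable M"
    using vrep_nL2(1)[OF mop_in_nL2[OF G x]] by (simp add: square_integrable_def)
  note [measurable] = this
  have "AE z in M. vrep (mop M G ?x) z = G z *v w z"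
    unfolding mop_vclass[OF G w] by (rule vrep_vclass) measurable
  then have "(\<integral>z. cdot (w z) (adjm (G z) *v vrep y z) \<partial>M) = nL2_inner M (mop M G ?x) y"
    unfolding nL2_inner_eq[OF mop_in_nL2[OF G x] y]
    by (intro integral_cong_AE; (measurable)?) (auto simp: cdot_adjm elim!: eventually_mono)
  also have "\<dots> = nL2_inner M ?x (S y)" using S x y by (simp add: is_adjoint_def)
  also have "\<dots> = (\<integral>z. cdot (w z) (vrep (S y) z) \<partial>M)"
    unfolding nL2_inner_eq[OF x Sy] using vrep_vclass[of w M]
    by (intro integral_cong_AE; (measurable)?) (auto elim!: eventually_mono)
  finally have eq: "(\<integral>z. cdot (w z) (vrep (S y) z) \<partial>M) - (\<integral>z. cdot (w z) (adjm (G z) *v vrep y z) \<partial>M) = 0"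
    by simp
  have diff: "cdot a (b - c) = cdot a b - cdot a c" for a b c :: "complex^'n"
    by (simp add: cdot_def sum_subtractf algebra_simps)
  have "complex_of_real (\<integral>z. (norm (w z))\<^sup>2 \<partial>M) = (\<integral>z. cdot (w z) (w z) \<partial>M)"
    by (simp add: cdot_self del: of_real_power)
  also have "\<dots> = (\<integral>z. cdot (w z) (vrep (S y) z) - cdot (w z) (adjm (G z) *v vrep y z) \<partial>M)"
    by (intro Bochner_Integration.integral_cong refl) (subst (2) w_def, simp add: diff)
  also have "\<dots> = 0"
    using eq integrable_cdot[OF w Syi] integrable_cdot[OF w Gsy] by simp
  finally have "(\<integral>z. (norm (w z))\<^sup>2 \<partial>M) = 0" by simp
  then have "AE z in M. (norm (w z))\<^sup>2 = 0"
    using w by (subst (asm) integral_nonneg_eq_0_iff_AE) (auto simp: square_integrable_def)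
  then have "AE z in M. vrep (S y) z = adjm (G z) *v vrep y z" by eventually_elim (simp add: w_def)
  then have "vclass M (vrep (S y)) = vclass M (\<lambda>z. adjm (G z) *v vrep y z)"
    by (subst vclass_eq_iff) measurable
  then show "S y = mop M (\<lambda>z. adjm (G z)) y"
    by (simp add: mop_apply[OF y] vrep_nL2(2)[OF Sy])
qed

lemma normal_op_mop:
  fixes G :: "'a \<Rightarrow> complex^'n^'n"
  assumes G: "ess_bounded M G" and "normal_op M (mop M G)"
  shows "AE z in M. G z ** adjm (G z) = adjm (G z) ** G z"
proof -
  obtain S where S: "is_adjoint M (mop M G) S" "op_mult M S (mop M G) = op_mult M (mop M G) S"
    using assms(2) by (auto simp: normal_op_def)
  note Gs = ess_bounded_adjm[OF G]
  have "mop M (\<lambda>z. G z ** adjm (G z)) = mop M (\<lambda>z. adjm (G z) ** G z)"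
    using S(2) by (simp add: adjoint_mop[OF G S(1)] op_mult_mop G Gs)
  then show ?thesis by (simp add: mop_eq_iff ess_bounded_mult G Gs)
qed

end

section \<open>Matching two diagonalizations\<close>

definition perm_matrix :: "('n \<Rightarrow> 'n) \<Rightarrow> complex^'n^'n" where
  "perm_matrix p = (\<chi> i j. if j = p i then 1 else 0)"

lemma perm_matrix_inverse:
  fixes p :: "'n::finite \<Rightarrow> 'n"
  assumes "bij p"
  shows "perm_matrix p ** transpose (perm_matrix p) = mat 1"
    and "transpose (perm_matrix p) ** perm_matrix p = mat 1"
proof -
  have "p i = p j \<longleftrightarrow> i = j" for i j using assms by (simp add: bij_is_inj inj_eq)
  then show "perm_matrix p ** transpose (perm_matrix p) = mat 1"
    by (simp add: vec_eq_iff matrix_matrix_mult_def perm_matrix_def transpose_def mat_def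
        if_distrib[of "\<lambda>a. b * a" for b] cong: if_cong)
  then show "transpose (perm_matrix p) ** perm_matrix p = mat 1"
    by (simp add: matrix_left_right_inverse)
qed

lemma perm_matrix_conj_entry:
  "(perm_matrix p ** X ** transpose (perm_matrix p)) $ i $ k = X $ p i $ p k"
  by (simp add: matrix_matrix_mult_def perm_matrix_def transpose_def
      if_distrib[of "\<lambda>a. b * a" for b] if_distrib[of "\<lambda>a. a * b" for b] cong: if_cong)

text \<open>Indices are written as \<open>p i\<close> and \<open>p k\<close> so that the inverse of
  \<open>p\<close> need not be named.\<close>

lemma perm_matrix_conj_entry':
  fixes p :: "'n::finite \<Rightarrow> 'n"
  assumes "bij p"
  shows "(transpose (perm_matrix p) ** X ** perm_matrix p) $ p i $ p k = X $ i $ k"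
proof -
  have "perm_matrix p ** (transpose (perm_matrix p) ** X ** perm_matrix p) ** transpose (perm_matrix p) = X"
    using perm_matrix_inverse[OF assms] by (metis matrix_mul_assoc matrix_mul_lid matrix_mul_rid)
  then show ?thesis using perm_matrix_conj_entry by metis
qed

lemma diagm_perm_conj: "inj p \<Longrightarrow> diagm X \<Longrightarrow> diagm (perm_matrix p ** X ** transpose (perm_matrix p))"
  by (auto simp: diagm_def perm_matrix_conj_entry dest: injD)

lemma diagm_perm_conj':
  fixes p :: "'n::finite \<Rightarrow> 'n"
  assumes "bij p" "diagm X"
  shows "diagm (transpose (perm_matrix p) ** X ** perm_matrix p)"
  unfolding diagm_def
proof (intro allI impI)
  fix a b :: 'n assume "a \<noteq> b"
  obtain i k where "a = p i" "b = p k" using assms(1) by (meson bij_pointE)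
  moreover from this have "i \<noteq> k" using \<open>a \<noteq> b\<close> by auto
  ultimately show "(transpose (perm_matrix p) ** X ** perm_matrix p) $ a $ b = 0"
    using assms by (simp add: perm_matrix_conj_entry' diagm_def)
qed

text \<open>Some term of the Leibniz expansion of the determinant of \<open>W\<close> is nonzero.\<close>

lemma similar_diagonal_permutation:
  fixes D D' W :: "complex^'n^'n"
  assumes D: "diagm D" "diagm D'" and W: "invertible W" "D ** W = W ** D'"
  shows "\<exists>p. bij p \<and> (\<forall>i. D $ i $ i = D' $ p i $ p i)"
proof -
  have "det W \<noteq> 0" using W(1) by (simp add: invertible_det_nz)
  then obtain p where p: "p permutes UNIV" "(\<Prod>i\<in>UNIV. W $ i $ p i) \<noteq> 0"
    unfolding det_def by (auto elim!: sum.not_neutral_contains_not_neutral)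
  have comm: "D $ i $ i * W $ i $ j = W $ i $ j * D' $ j $ j" for i j
  proof -
    have "D $ i $ i * W $ i $ j = (\<Sum>k\<in>UNIV. D $ i $ k * W $ k $ j)"
      using D(1) by (subst sum.mono_neutral_right[of UNIV "{i}"]) (auto simp: diagm_def)
    also have "\<dots> = (D ** W) $ i $ j" by (simp add: matrix_matrix_mult_def)
    also have "\<dots> = (W ** D') $ i $ j" by (simp only: W(2))
    also have "\<dots> = (\<Sum>k\<in>UNIV. W $ i $ k * D' $ k $ j)" by (simp add: matrix_matrix_mult_def)
    also have "\<dots> = W $ i $ j * D' $ j $ j"
      using D(2) by (subst sum.mono_neutral_right[of UNIV "{j}"]) (auto simp: diagm_def)
    finally show ?thesis .
  qed
  have "W $ i $ p i \<noteq> 0" for i using p(2) by simp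
  then have "D $ i $ i = D' $ p i $ p i" for i using comm[of i "p i"] by (simp add: mult.commute)
  then show ?thesis using permutes_bij[OF p(1)] by blast
qed

text \<open>Conjugating \<open>D'\<close> by the permutation matrix gives entries
  \<open>D' $ p i $ p k\<close>, which are those of \<open>D\<close>: on the diagonal by assumption,
  off it because \<open>p\<close> is injective.\<close>

lemma matching_permutation_conj:
  fixes p :: "'n::finite \<Rightarrow> 'n"
  assumes "diagm D" "diagm D'" "bij p" "\<And>i. D $ i $ i = D' $ p i $ p i"
  shows "transpose (perm_matrix p) ** D = D' ** transpose (perm_matrix p)"
proof -
  have "p i = p k \<longleftrightarrow> i = k" for i k using assms(3) by (simp add: bij_is_inj inj_eq)
  then have "D $ i $ k = D' $ p i $ p k" for i k
    using assms by (cases "i = k") (simp_all add: diagm_def)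
  then have "perm_matrix p ** D' ** transpose (perm_matrix p) = D"
    by (simp add: vec_eq_iff perm_matrix_conj_entry)
  then show ?thesis
    using perm_matrix_inverse[OF assms(3)] by (metis matrix_mul_assoc matrix_mul_lid)
qed

lemma ess_bounded_perm_matrix:
  fixes p :: "'a \<Rightarrow> 'n::finite \<Rightarrow> 'n"
  assumes "p \<in> measurable M (count_space UNIV)"
  shows "ess_bounded M (\<lambda>z. perm_matrix (p z))" "ess_bounded M (\<lambda>z. transpose (perm_matrix (p z)))"
proof -
  have "norm (perm_matrix (p z)) \<le> real CARD('n) * real CARD('n) * 1"
    "norm (transpose (perm_matrix (p z))) \<le> real CARD('n) * real CARD('n) * 1" for z
    by (rule norm_matrix_le; simp add: perm_matrix_def transpose_def)+
  moreover have "(\<lambda>z. perm_matrix (p z)) \<in> borel_measurable M"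
    "(\<lambda>z. transpose (perm_matrix (p z))) \<in> borel_measurable M"
    using measurable_compose[OF assms, of perm_matrix borel]
      measurable_compose[OF assms, of "\<lambda>k. transpose (perm_matrix k)" borel] by simp_all
  ultimately show "ess_bounded M (\<lambda>z. perm_matrix (p z))" "ess_bounded M (\<lambda>z. transpose (perm_matrix (p z)))"
    unfolding ess_bounded_def by blast+
qed

text \<open>\<open>X\<close> carries the columns of \<open>U\<close> to the columns of
  \<open>U' ** P'\<close>; read in the two frames, conjugation by \<open>X\<close> is conjugation by
  \<open>P'\<close>. Commutation with \<open>B\<close> reduces to \<open>P'\<close> intertwining the
  matrices of \<open>B\<close> in the two frames.\<close>

lemma change_of_frame:
  fixes U V U' V' P P' :: "complex^'n^'n"
  assumes inv: "V ** U = mat 1" "U ** V = mat 1" "V' ** U' = mat 1" "U' ** V' = mat 1"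
      "P ** P' = mat 1" "P' ** P = mat 1"
  defines "X \<equiv> U' ** P' ** V" and "Y \<equiv> U ** P ** V'"
  shows "X ** Y = mat 1" "Y ** X = mat 1"
    "V' ** (X ** (G ** Y)) ** U' = P' ** (V ** G ** U) ** P"
    "V ** (Y ** (G ** X)) ** U = P ** (V' ** G ** U') ** P'"
    "P' ** (V ** B ** U) = (V' ** B ** U') ** P' \<Longrightarrow> B ** X = X ** B"
    "P' ** (V ** B ** U) = (V' ** B ** U') ** P' \<Longrightarrow> B ** Y = Y ** B"
proof -
  have cancel: "V ** (U ** Z) = Z" "U ** (V ** Z) = Z" "V' ** (U' ** Z) = Z" "U' ** (V' ** Z) = Z"
      "P ** (P' ** Z) = Z" "P' ** (P ** Z) = Z" for Z :: "complex^'n^'n"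
    using inv by (metis matrix_mul_assoc matrix_mul_lid)+
  note assoc = matrix_mul_assoc[symmetric]
  show XY: "X ** Y = mat 1" and YX: "Y ** X = mat 1"
    by (simp_all add: X_def Y_def assoc cancel inv)
  show "V' ** (X ** (G ** Y)) ** U' = P' ** (V ** G ** U) ** P"
    "V ** (Y ** (G ** X)) ** U = P ** (V' ** G ** U') ** P'"
    by (simp_all add: X_def Y_def assoc cancel inv)
  assume *: "P' ** (V ** B ** U) = (V' ** B ** U') ** P'"
  have "U' ** (P' ** (V ** B ** U)) ** V = U' ** ((V' ** B ** U') ** P') ** V"
    using * by simp
  then show BX: "B ** X = X ** B" by (simp add: X_def assoc cancel inv)
  then show "B ** Y = Y ** B" using XY YX by (metis matrix_mul_assoc matrix_mul_lid matrix_mul_rid)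
qed

section \<open>Transfer to operators and the similarity\<close>

context finite_measure
begin

lemma rel_commutant_mop:
  fixes A :: "'a \<Rightarrow> complex^'n^'n"
  assumes "ess_bounded M A" "ess_bounded M G"
  shows "mop M G \<in> rel_commutant M (mop M A) \<longleftrightarrow> (AE z in M. A z ** G z = G z ** A z)"
  using assms by (auto simp: rel_commutant_def Mn_Linf_eq op_mult_mop mop_eq_iff ess_bounded_mult)

text \<open>All representatives are included, so a measurable change on a null set does not affect
  membership.\<close>

definition symbols :: "('a, 'n::finite) nL2_op set \<Rightarrow> ('a \<Rightarrow> complex^'n^'n) set" where
  "symbols \<P> = {G. ess_bounded M G \<and> mop M G \<in> \<P>}"

lemma mop_symbols: "\<P> \<subseteq> Mn_Linf M \<Longrightarrow> mop M ` symbols \<P> = \<P>"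
  by (auto simp: symbols_def Mn_Linf_eq)

text \<open>Operator relations become fibrewise relations through \<open>mop_eq_iff\<close>. For
  maximality, a bounded idempotent \<open>R\<close> that commutes with \<open>A\<close> and the
  family is adjoined to \<open>\<P>\<close> as an operator, and the enlarged set must coincide with
  \<open>\<P>\<close>.\<close>

lemma max_abelian_symbols:
  fixes A :: "'a \<Rightarrow> complex^'n^'n"
  assumes A: "ess_bounded M A" "normal_op M (mop M A)"
    and P: "bounded_max_abelian_idempotents M (rel_commutant M (mop M A)) \<P>"
  shows "\<exists>C. max_abelian M A (symbols \<P>) C"
proof -
  have ab: "\<P> \<subseteq> rel_commutant M (mop M A)" "\<And>S. S \<in> \<P> \<Longrightarrow> op_mult M S S = S"
      "\<And>S T. S \<in> \<P> \<Longrightarrow> T \<in> \<P> \<Longrightarrow> op_mult M S T = op_mult M T S"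
    and max: "\<And>\<R>. abelian_idempotents M (rel_commutant M (mop M A)) \<R> \<Longrightarrow> \<P> \<subseteq> \<R> \<Longrightarrow> \<R> = \<P>"
    using P by (auto simp: bounded_max_abelian_idempotents_def abelian_idempotents_def)
  obtain C where C: "\<And>S. S \<in> \<P> \<Longrightarrow> op_norm M S \<le> C"
    using P by (auto simp: bounded_max_abelian_idempotents_def)
  have PM: "\<P> \<subseteq> Mn_Linf M" using ab(1) by (auto simp: rel_commutant_def)
  have sym: "ess_bounded M G" "mop M G \<in> \<P>" if "G \<in> symbols \<P>" for G
    using that by (auto simp: symbols_def)
  \<comment> \<open>The operator bound \<open>C\<close> limits each of the n^2 entries, whence the
    factor.\<close>
  have "max_abelian_axioms M A (symbols \<P>) (real CARD('n) * real CARD('n) * C)"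
  proof
    show "A \<in> borel_measurable M" using A(1) by (simp add: ess_bounded_def)
    show "AE z in M. A z ** adjm (A z) = adjm (A z) ** A z" by (rule normal_op_mop[OF A])
  next
    fix G assume G: "G \<in> symbols \<P>"
    note s = sym[OF G]
    show "G \<in> borel_measurable M" using s by (simp add: ess_bounded_def)
    have "AE z in M. \<forall>i j. cmod (G z $ i $ j) \<le> C"
      unfolding AE_all_countable using entry_le_op_norm[OF s(1) C[OF s(2)]] by blast
    then show "AE z in M. norm (G z) \<le> real CARD('n) * real CARD('n) * C"
      by eventually_elim (rule norm_matrix_le, simp)
    show "AE z in M. G z ** G z = G z"
      using ab(2)[OF s(2)] s(1) by (simp add: op_mult_mop mop_eq_iff ess_bounded_mult)
    show "AE z in M. A z ** G z = G z ** A z"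
      using ab(1) s rel_commutant_mop[OF A(1) s(1)] by blast
    fix H assume H: "H \<in> symbols \<P>"
    show "AE z in M. G z ** H z = H z ** G z"
      using ab(3)[OF s(2) sym(2)[OF H]] s(1) sym(1)[OF H]
      by (simp add: op_mult_mop mop_eq_iff ess_bounded_mult)
  next
    fix R c
    assume R: "R \<in> borel_measurable M" "AE z in M. norm (R z) \<le> c"
      and RR: "AE z in M. R z ** R z = R z" and AR: "AE z in M. A z ** R z = R z ** A z"
      and comm: "\<And>G. G \<in> symbols \<P> \<Longrightarrow> AE z in M. G z ** R z = R z ** G z"
    have Rb: "ess_bounded M R" using R by (auto simp: ess_bounded_def)
    have cR: "op_mult M S (mop M R) = op_mult M (mop M R) S" if S: "S \<in> \<P>" for S
    proof -
      obtain G where G: "G \<in> symbols \<P>" "S = mop M G" using mop_symbols[OF PM] S by blast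
      then show ?thesis
        using comm[OF G(1)] sym(1)[OF G(1)] Rb by (simp add: op_mult_mop mop_eq_iff ess_bounded_mult)
    qed
    have "abelian_idempotents M (rel_commutant M (mop M A)) (insert (mop M R) \<P>)"
      unfolding abelian_idempotents_def
    proof (intro conjI ballI)
      show "insert (mop M R) \<P> \<subseteq> rel_commutant M (mop M A)"
        using ab(1) rel_commutant_mop[OF A(1) Rb] AR by auto
      show "op_mult M S S = S" if "S \<in> insert (mop M R) \<P>" for S
        using that ab(2) RR Rb by (auto simp: op_mult_mop mop_eq_iff ess_bounded_mult)
      show "op_mult M S T = op_mult M T S" if "S \<in> insert (mop M R) \<P>" "T \<in> insert (mop M R) \<P>" for S T
        using that ab(3) cR by auto
    qed
    from max[OF this] have "mop M R \<in> \<P>" by blast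
    then show "R \<in> symbols \<P>" using Rb by (simp add: symbols_def)
  qed
  then show ?thesis using finite_measure_axioms by (blast intro: max_abelian.intro)
qed

theorem similar_max_abelian_idempotents:
  fixes A :: "('a, 'n::finite) nL2_op"
  assumes "A \<in> Mn_Linf M" "normal_op M A"
    and P: "bounded_max_abelian_idempotents M (rel_commutant M A) \<P>"
    and Q: "bounded_max_abelian_idempotents M (rel_commutant M A) \<Q>"
  shows "\<exists>X\<in>rel_commutant M A. \<exists>Y\<in>rel_commutant M A.
    op_mult M X Y = op_one M \<and> op_mult M Y X = op_one M \<and>
    (\<lambda>P. op_mult M X (op_mult M P Y)) ` \<P> = \<Q>"
proof -
  obtain B where B: "ess_bounded M B" and A: "A = mop M B" using assms(1) by (auto simp: Mn_Linf_eq)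
  obtain C where "max_abelian M B (symbols \<P>) C"
    using max_abelian_symbols[OF B] assms(2) P A by blast
  from max_abelian.exists_diagonalization[OF this] obtain U V where
    UV: "ess_bounded M U" "ess_bounded M V"
    and inv: "AE z in M. V z ** U z = mat 1 \<and> U z ** V z = mat 1"
    and diag: "AE z in M. diagm (V z ** B z ** U z)"
    and memP: "\<forall>G. ess_bounded M G \<longrightarrow>
      (G \<in> symbols \<P> \<longleftrightarrow> (AE z in M. diagm (V z ** G z ** U z) \<and> G z ** G z = G z))"
    by (elim exE conjE)
  obtain C' where "max_abelian M B (symbols \<Q>) C'"
    using max_abelian_symbols[OF B] assms(2) Q A by blast
  from max_abelian.exists_diagonalization[OF this] obtain U' V' where
    UV': "ess_bounded M U'" "ess_bounded M V'"
    and inv': "AE z in M. V' z ** U' z = mat 1 \<and> U' z ** V' z = mat 1"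
    and diag': "AE z in M. diagm (V' z ** B z ** U' z)"
    and memQ: "\<forall>G. ess_bounded M G \<longrightarrow>
      (G \<in> symbols \<Q> \<longleftrightarrow> (AE z in M. diagm (V' z ** G z ** U' z) \<and> G z ** G z = G z))"
    by (elim exE conjE)
  define D where "D = (\<lambda>z. V z ** B z ** U z)"
  define D' where "D' = (\<lambda>z. V' z ** B z ** U' z)"
  have [measurable]: "B \<in> borel_measurable M" using B by (simp add: ess_bounded_def)
  have [measurable]: "U \<in> borel_measurable M" "V \<in> borel_measurable M"
      "U' \<in> borel_measurable M" "V' \<in> borel_measurable M"
    using UV UV' by (simp_all add: ess_bounded_def)
  have [measurable]: "D \<in> borel_measurable M" "D' \<in> borel_measurable M"
    unfolding D_def D'_def by measurable
  \<comment> \<open>A matching is sought among the finitely many maps \<open>k\<close>; for each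
    fixed \<open>k\<close> the condition compares measurable entries.\<close>
  have "Measurable.pred M (\<lambda>z. bij k \<and> (\<forall>i. D z $ i $ i = D' z $ k i $ k i))" for k :: "'n \<Rightarrow> 'n"
    by measurable
  from measurable_choice_countable[of "\<lambda>k z. bij k \<and> (\<forall>i. D z $ i $ i = D' z $ k i $ k i)", OF this]
  obtain p where p_meas: "p \<in> measurable M (count_space UNIV)"
    and p: "\<And>z. \<exists>k. bij k \<and> (\<forall>i. D z $ i $ i = D' z $ k i $ k i) \<Longrightarrow>
      bij (p z) \<and> (\<forall>i. D z $ i $ i = D' z $ p z i $ p z i)"
    by blast
  let ?P = "\<lambda>z. perm_matrix (p z)" and ?P' = "\<lambda>z. transpose (perm_matrix (p z))"
  \<comment> \<open>Coordinates in the first frame, a reordering, then the second frame.\<close>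
  define X where "X = (\<lambda>z. U' z ** ?P' z ** V z)"
  define Y where "Y = (\<lambda>z. U z ** ?P z ** V' z)"
  have X: "ess_bounded M X" and Y: "ess_bounded M Y"
    unfolding X_def Y_def by (intro ess_bounded_mult UV UV' ess_bounded_perm_matrix p_meas)+
  have good: "AE z in M. bij (p z) \<and> ?P' z ** D z = D' z ** ?P' z"
    using inv inv' diag diag'
  proof eventually_elim
    case (elim z)
    \<comment> \<open>\<open>D z\<close> and \<open>D' z\<close> represent \<open>B z\<close> in two
      frames, so the transition matrix intertwines them and a matching permutation exists.\<close>
    let ?W = "V z ** U' z"
    have "?W ** (V' z ** U z) = mat 1" "(V' z ** U z) ** ?W = mat 1"
      using elim(1,2) by (metis matrix_mul_assoc matrix_mul_lid)+
    then have "invertible ?W" by (auto simp: invertible_def)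
    moreover have "D z ** ?W = ?W ** D' z"
      unfolding D_def D'_def using elim(1,2) by (metis matrix_mul_assoc matrix_mul_lid)
    ultimately have "bij (p z) \<and> (\<forall>i. D z $ i $ i = D' z $ p z i $ p z i)"
      using elim(3,4) by (intro p similar_diagonal_permutation) (auto simp: D_def D'_def)
    then show ?case
      using matching_permutation_conj[of "D z" "D' z" "p z"] elim(3,4) by (auto simp: D_def D'_def)
  qed
  \<comment> \<open>The formulas hold for all matrices \<open>G\<close> off one null set, so the
    values of any matrix function may be inserted.\<close>
  have frames: "AE z in M. X z ** Y z = mat 1 \<and> Y z ** X z = mat 1 \<and> B z ** X z = X z ** B z \<and>
      B z ** Y z = Y z ** B z \<and> inj (p z) \<and> bij (p z) \<and>
      (\<forall>G. V' z ** (X z ** (G ** Y z)) ** U' z = ?P' z ** (V z ** G ** U z) ** ?P z) \<and>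
      (\<forall>G. V z ** (Y z ** (G ** X z)) ** U z = ?P z ** (V' z ** G ** U' z) ** ?P' z)"
    using inv inv' good
  proof eventually_elim
    case (elim z)
    have bij: "bij (p z)" using elim(3) by simp
    have "?P' z ** (V z ** B z ** U z) = (V' z ** B z ** U' z) ** ?P' z"
      using elim(3) by (simp add: D_def D'_def)
    note c = change_of_frame[OF elim(1)[THEN conjunct1] elim(1)[THEN conjunct2]
        elim(2)[THEN conjunct1] elim(2)[THEN conjunct2] perm_matrix_inverse[OF bij]]
      and c' = change_of_frame(5,6)[OF elim(1)[THEN conjunct1] elim(1)[THEN conjunct2]
        elim(2)[THEN conjunct1] elim(2)[THEN conjunct2] perm_matrix_inverse[OF bij] this]
    show ?case
      unfolding X_def Y_def by (intro conjI allI c(1-4) c' bij bij_is_inj[OF bij])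
  qed
  have XA: "mop M X \<in> rel_commutant M A"
    unfolding A rel_commutant_mop[OF B X] using frames by (rule eventually_mono) blast
  have YA: "mop M Y \<in> rel_commutant M A"
    unfolding A rel_commutant_mop[OF B Y] using frames by (rule eventually_mono) blast
  have XY: "op_mult M (mop M X) (mop M Y) = op_one M"
    unfolding op_mult_mop[OF X Y] op_one_mop mop_eq_iff[OF ess_bounded_mult[OF X Y] ess_bounded_const]
    using frames by (rule eventually_mono) blast
  have YX: "op_mult M (mop M Y) (mop M X) = op_one M"
    unfolding op_mult_mop[OF Y X] op_one_mop mop_eq_iff[OF ess_bounded_mult[OF Y X] ess_bounded_const]
    using frames by (rule eventually_mono) blast
  have PM: "\<P> \<subseteq> Mn_Linf M" "\<Q> \<subseteq> Mn_Linf M"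
    using P Q by (auto simp: bounded_max_abelian_idempotents_def abelian_idempotents_def rel_commutant_def)
  have idem_conj: "(S ** (T ** R)) ** (S ** (T ** R)) = S ** (T ** R)"
    if "R ** S = mat 1" "T ** T = T" for R S T :: "complex^'n^'n"
    using that by (metis matrix_mul_assoc matrix_mul_lid)
  have toQ: "(\<lambda>z. X z ** (G z ** Y z)) \<in> symbols \<Q>" if G: "G \<in> symbols \<P>" for G
  proof -
    have Gb: "ess_bounded M G" using G by (simp add: symbols_def)
    have "AE z in M. diagm (V z ** G z ** U z) \<and> G z ** G z = G z" using memP Gb G by blast
    then have "AE z in M. diagm (V' z ** (X z ** (G z ** Y z)) ** U' z) \<and>
        (X z ** (G z ** Y z)) ** (X z ** (G z ** Y z)) = X z ** (G z ** Y z)"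
      using frames by eventually_elim (simp add: diagm_perm_conj' idem_conj)
    then show ?thesis using memQ ess_bounded_mult[OF X ess_bounded_mult[OF Gb Y]] by blast
  qed
  have toP: "(\<lambda>z. Y z ** (G z ** X z)) \<in> symbols \<P>" if G: "G \<in> symbols \<Q>" for G
  proof -
    have Gb: "ess_bounded M G" using G by (simp add: symbols_def)
    have "AE z in M. diagm (V' z ** G z ** U' z) \<and> G z ** G z = G z" using memQ Gb G by blast
    then have "AE z in M. diagm (V z ** (Y z ** (G z ** X z)) ** U z) \<and>
        (Y z ** (G z ** X z)) ** (Y z ** (G z ** X z)) = Y z ** (G z ** X z)"
      using frames by eventually_elim (simp add: diagm_perm_conj idem_conj)
    then show ?thesis using memP ess_bounded_mult[OF Y ess_bounded_mult[OF Gb X]] by blast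
  qed
  have conj: "op_mult M (mop M X) (op_mult M (mop M G) (mop M Y)) = mop M (\<lambda>z. X z ** (G z ** Y z))"
    if "ess_bounded M G" for G
    using that X Y by (simp add: op_mult_mop ess_bounded_mult)
  have "(\<lambda>P. op_mult M (mop M X) (op_mult M P (mop M Y))) ` \<P> = \<Q>"
  proof (intro equalityI subsetI)
    fix S assume "S \<in> (\<lambda>P. op_mult M (mop M X) (op_mult M P (mop M Y))) ` \<P>"
    then obtain T where T: "S = op_mult M (mop M X) (op_mult M T (mop M Y))" "T \<in> \<P>" by (rule imageE)
    then have "T \<in> mop M ` symbols \<P>" using mop_symbols[OF PM(1)] by simp
    then obtain G where G: "T = mop M G" "G \<in> symbols \<P>" by (rule imageE)
    have "S = mop M (\<lambda>z. X z ** (G z ** Y z))"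
      unfolding T(1) G(1) by (rule conj) (use G(2) in \<open>simp add: symbols_def\<close>)
    then show "S \<in> \<Q>" using toQ[OF G(2)] by (simp add: symbols_def)
  next
    fix S assume "S \<in> \<Q>"
    then have "S \<in> mop M ` symbols \<Q>" using mop_symbols[OF PM(2)] by simp
    then obtain G where G: "S = mop M G" "G \<in> symbols \<Q>" by (rule imageE)
    have Gb: "ess_bounded M G" using G by (simp add: symbols_def)
    \<comment> \<open>The preimage of \<open>S\<close> is Y S X, and X Y = 1 restores
      \<open>S\<close>.\<close>
    note H = toP[OF G(2)]
    have Hb: "ess_bounded M (\<lambda>z. Y z ** (G z ** X z))" by (intro ess_bounded_mult X Y Gb)
    have "AE z in M. X z ** ((Y z ** (G z ** X z)) ** Y z) = G z"
      using frames
    proof eventually_elim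
      case (elim z)
      have "X z ** ((Y z ** (G z ** X z)) ** Y z) = (X z ** Y z) ** G z ** (X z ** Y z)"
        by (simp add: matrix_mul_assoc)
      then show ?case using elim by simp
    qed
    then have "S = op_mult M (mop M X) (op_mult M (mop M (\<lambda>z. Y z ** (G z ** X z))) (mop M Y))"
      unfolding conj[OF Hb] G(1) using mop_eq_iff[OF ess_bounded_mult[OF X ess_bounded_mult[OF Hb Y]] Gb] by simp
    moreover have "mop M (\<lambda>z. Y z ** (G z ** X z)) \<in> \<P>" using H by (simp add: symbols_def)
    ultimately show "S \<in> (\<lambda>P. op_mult M (mop M X) (op_mult M P (mop M Y))) ` \<P>" by (rule image_eqI)
  qed
  then show ?thesis using XA YA XY YX by blast
qed

end

theorem corollary3p10:
  fixes \<nu> \<mu> :: "complex measure" and \<Lambda> :: "complex set"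
    and A :: "(complex, 'n::finite) nL2_op"
  assumes "finite_measure \<nu>" and "regular_borel_measure \<nu>"
    and "compact \<Lambda>" and "emeasure \<nu> (- \<Lambda>) = 0"
    and "\<mu> = completion \<nu>"
    and "A \<in> Mn_Linf \<mu>" and "normal_op \<mu> A"
  shows "\<forall>\<P> \<Q>. bounded_max_abelian_idempotents \<mu> (rel_commutant \<mu> A) \<P> \<and>
           bounded_max_abelian_idempotents \<mu> (rel_commutant \<mu> A) \<Q> \<longrightarrow>
           (\<exists>X\<in>rel_commutant \<mu> A. \<exists>Y\<in>rel_commutant \<mu> A.
              op_mult \<mu> X Y = op_one \<mu> \<and> op_mult \<mu> Y X = op_one \<mu> \<and>
              (\<lambda>P. op_mult \<mu> X (op_mult \<mu> P Y)) ` \<P> = \<Q>)"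
proof -
  \<comment> \<open>Completion does not change the total mass, so finiteness passes from
    \<open>\<nu>\<close> to \<open>\<mu>\<close>.\<close>
  have "finite_measure \<mu>"
    using finite_measure.emeasure_finite[OF assms(1), of "space \<nu>"] assms(5)
    by (intro finite_measureI) (simp add: emeasure_completion)
  then show ?thesis
    using finite_measure.similar_max_abelian_idempotents[OF _ assms(6,7)] by blast
qed

end
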